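(* Let $(W,S)$ be a Coxeter system of type $D_n$, $n\ge 3$. Then, for all $1\le j,k\le n$, $$x_j\, x_k= \sum_{l=0}^{\min(j,k)}\binom{n-j}{k-l}\binom{n-k}{j-l}(n-j-k+l)!\,2^{n-j-k+l}\,x_{l},$$ where $x_0:=2x_1$. In particular, $x_j\,x_1=\frac{n!}{j!}\,2^{n-j}\,x_1$ for $1\le j\le n$.
   Context: For a finite Coxeter system $(W,S)$ with length function $\ell$ and $J\subseteq S$, let $X_J=\{w\in W: \ell(ws)>\ell(w)\text{ for all } s\in J\}$ and $x_J=\sum_{w\in X_J} w$ in the group algebra $\mathbb{Q}W$. For type $D_n$ label $S=\{s_1,\dots,s_n\}$ so that $s_1s_3$, $s_2s_3$ and $s_is_{i+1}$ for $3\le i\le n-1$ have order $3$, and all other pairs of distinct generators commute. Put $x_j=x_{\{s_1,\dots,s_j\}}$ for $2\le j\le n$ (so $x_n=1$), and $x_1=x_\emptyset=\sum_{w\in W}w$ (not $x_{\{s_1\}}$). Convention: terms with $n-j-k+l<0$ are zero (then both binomial coefficients vanish). *)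

theory Defs
  imports "HOL-Algebra.Algebra" "HOL-Library.Poly_Mapping"
begin

definition word_prod :: "('a, 'b) monoid_scheme \<Rightarrow> 'a list \<Rightarrow> 'a" where
  "word_prod W ws = foldr (\<lambda>s w. s \<otimes>\<^bsub>W\<^esub> w) ws \<one>\<^bsub>W\<^esub>"

text \<open>
  One application of a defining relation \<open>(s t)\<^sup>m = 1\<close> to a word over \<open>S\<close>, where \<open>m\<close> is the order
  of \<open>s t\<close> in \<open>W\<close>. For an element of infinite order, \<open>group.ord\<close> is 0 and the relation is
  trivial. For \<open>s = t\<close> the order is 1 and the relation reads \<open>s s = 1\<close>; hence words in the
  generators alone (without formal inverses) present a group.
\<close>

inductive coxeter_step :: "('a, 'b) monoid_scheme \<Rightarrow> 'a set \<Rightarrow> 'a list \<Rightarrow> 'a list \<Rightarrow> bool"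
  for W :: "('a, 'b) monoid_scheme" and S :: "'a set" where
  "u \<in> lists S \<Longrightarrow> v \<in> lists S \<Longrightarrow> s \<in> S \<Longrightarrow> t \<in> S \<Longrightarrow>
     coxeter_step W S (u @ concat (replicate (group.ord W (s \<otimes>\<^bsub>W\<^esub> t)) [s, t]) @ v) (u @ v)"

text \<open>
  Bourbaki's definition: \<open>S\<close> is a generating set of involutions, and the relations
  \<open>(s t)\<^sup>m = 1\<close> with \<open>m\<close> the order of \<open>s t\<close> form a presentation of \<open>W\<close>, i.e. two words over \<open>S\<close>
  represent the same element of \<open>W\<close> iff they are equivalent modulo these relations.
\<close>

definition coxeter_system :: "('a, 'b) monoid_scheme \<Rightarrow> 'a set \<Rightarrow> bool" where
  "coxeter_system W S \<longleftrightarrow>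
     group W \<and> S \<subseteq> carrier W \<and> generate W S = carrier W \<and>
     (\<forall>s\<in>S. group.ord W s = 2) \<and>
     (\<forall>u\<in>lists S. \<forall>v\<in>lists S.
        word_prod W u = word_prod W v \<longleftrightarrow> equivclp (coxeter_step W S) u v)"

definition coxeter_length :: "('a, 'b) monoid_scheme \<Rightarrow> 'a set \<Rightarrow> 'a \<Rightarrow> nat" where
  "coxeter_length W S w = (LEAST k. \<exists>ws\<in>lists S. length ws = k \<and> word_prod W ws = w)"

definition coxeter_X :: "('a, 'b) monoid_scheme \<Rightarrow> 'a set \<Rightarrow> 'a set \<Rightarrow> 'a set" where
  "coxeter_X W S J =
     {w \<in> carrier W. \<forall>s\<in>J. coxeter_length W S (w \<otimes>\<^bsub>W\<^esub> s) > coxeter_length W S w}"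

text \<open>
  The group algebra over the rationals: elements are the finitely supported functions
  \<open>'a \<Rightarrow>\<^sub>0 rat\<close> with support in \<open>carrier W\<close>. The product is the bilinear extension of the
  multiplication of \<open>W\<close>; the product of type \<open>poly_mapping\<close> itself is not applicable, since it
  convolves along an additive type class structure on \<open>'a\<close>.
\<close>

definition galg_mult ::
  "('a, 'b) monoid_scheme \<Rightarrow> ('a \<Rightarrow>\<^sub>0 rat) \<Rightarrow> ('a \<Rightarrow>\<^sub>0 rat) \<Rightarrow> ('a \<Rightarrow>\<^sub>0 rat)"  where
  "galg_mult W p q =
     (\<Sum>u\<in>Poly_Mapping.keys p. \<Sum>v\<in>Poly_Mapping.keys q.
        Poly_Mapping.single (u \<otimes>\<^bsub>W\<^esub> v) (Poly_Mapping.lookup p u * Poly_Mapping.lookup q v))"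

definition galg_scale :: "rat \<Rightarrow> ('a \<Rightarrow>\<^sub>0 rat) \<Rightarrow> ('a \<Rightarrow>\<^sub>0 rat)" where
  "galg_scale c p = Poly_Mapping.map (\<lambda>a. c * a) p"

text \<open>Meaningful for finite \<open>W\<close> only: a sum over an infinite set is 0 by convention.\<close>

definition coxeter_x :: "('a, 'b) monoid_scheme \<Rightarrow> 'a set \<Rightarrow> 'a set \<Rightarrow> ('a \<Rightarrow>\<^sub>0 rat)" where
  "coxeter_x W S J = (\<Sum>w\<in>coxeter_X W S J. Poly_Mapping.single w 1)"

text \<open>Edges \<open>i < j\<close> of the Dynkin diagram: the nodes 1 and 2 are the two prongs of the fork at 3.\<close>

definition type_D_edge :: "nat \<Rightarrow> nat \<Rightarrow> bool" where
  "type_D_edge i j \<longleftrightarrow> (i = 1 \<and> j = 3) \<or> (i = 2 \<and> j = 3) \<or> (3 \<le> i \<and> j = i + 1)"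

definition coxeter_system_D :: "('a, 'b) monoid_scheme \<Rightarrow> nat \<Rightarrow> (nat \<Rightarrow> 'a) \<Rightarrow> bool" where
  "coxeter_system_D W n s \<longleftrightarrow>
     coxeter_system W (s ` {1..n}) \<and> inj_on s {1..n} \<and>
     (\<forall>i\<in>{1..n}. \<forall>j\<in>{1..n}. i < j \<longrightarrow>
        (if type_D_edge i j then group.ord W (s i \<otimes>\<^bsub>W\<^esub> s j) = 3
         else s i \<otimes>\<^bsub>W\<^esub> s j = s j \<otimes>\<^bsub>W\<^esub> s i))"

text \<open>
  The index 1 stands for \<open>J = {}\<close> (not for \<open>J = {s 1}\<close>), and the element with index 0 is twice
  the element with index 1.
\<close>

definition x_D :: "('a, 'b) monoid_scheme \<Rightarrow> nat \<Rightarrow> (nat \<Rightarrow> 'a) \<Rightarrow> nat \<Rightarrow> ('a \<Rightarrow>\<^sub>0 rat)" where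
  "x_D W n s j =
     (if j = 0 then galg_scale 2 (coxeter_x W (s ` {1..n}) {})
      else if j = 1 then coxeter_x W (s ` {1..n}) {}
      else coxeter_x W (s ` {1..n}) (s ` {1..j}))"

end

(*
  W acts on the signed coordinates -n, ..., n. With respect to this action X_J for
  J = {s 1, ..., s k} consists of the w with |w p| < w q whenever 1 <= p < q <= k; for k = 1
  this condition is empty, in accordance with x 1 = x_{}. The elements c of X_{n-1} are
  determined by c n, which may be any of the 2n signed coordinates. For u in W write
  c n = u r; for k >= 2, c^-1 u lies in X_k iff either |r| > k and u is in X_k, or
  r = k and u is in X_{k-1}. Counting the r gives
    x_{n-1} x_k = 2 (n - k) x_k + x_{k-1}     (1 <= k <= n),   x_{n-1} x_0 = 2 n x_0,
  so with a = x_{n-1} every x_k is the falling factorial a (a - 2) ... (a - 2 (n - k - 1)),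
  and the theorem is the expansion of a product of two such factorials.
*)
theory Submission
  imports Defs "HOL-Combinatorics.Permutations"
begin

section \<open>The group algebra\<close>

text \<open>\<open>W\<close> is given only by its presentation and \<open>coxeter_X\<close> only by
  lengths, so the overview rests on a bridge from lengths to coordinates: the action is built by
  checking the relators, and then \<open>s i\<close> is shown to be an ascent of \<open>w\<close>
  iff \<open>w\<close> keeps the simple root of \<open>s i\<close> positive. The bridge also yields
  faithfulness and hence finiteness of \<open>W\<close>, which is not assumed and gives the sums
  \<open>coxeter_x\<close> their meaning. The condition |w p| < w q, rather than plain monotonicity,
  comes from the fork: keeping e_2 - e_1 and e_2 + e_1 positive leaves the sign of w 1 open. It is
  also the relation that c in X_{n-1} preserves and reflects on the coordinates up to n - 1, which
  is why c^-1 u can be compared with u. The value x_0 = 2 x_1 comes from the recursion at k = 1: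
  since X_1 = W, all 2n choices of r count, and 2n x_1 = 2 (n - 1) x_1 + 2 x_1. The next factor a -
  2n kills x_0, so the falling factorials end there.\<close>

lemma lookup_galg_scale [simp]:
  "Poly_Mapping.lookup (galg_scale c p) w = c * Poly_Mapping.lookup p w"
  unfolding galg_scale_def by (simp add: Poly_Mapping.map.rep_eq when_def)

lemma galg_scale_zero_left [simp]: "galg_scale 0 p = 0"
  by (intro poly_mapping_eqI) simp

lemma galg_scale_zero_right [simp]: "galg_scale c 0 = 0"
  by (intro poly_mapping_eqI) simp

lemma galg_scale_one [simp]: "galg_scale 1 p = p"
  by (intro poly_mapping_eqI) simp

lemma galg_scale_scale: "galg_scale c (galg_scale d p) = galg_scale (c * d) p"
  by (intro poly_mapping_eqI) simp

lemma galg_scale_add_left: "galg_scale (c + d) p = galg_scale c p + galg_scale d p"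
  by (intro poly_mapping_eqI) (simp add: lookup_add algebra_simps)

lemma galg_scale_sum_right: "galg_scale c (\<Sum>i\<in>I. f i) = (\<Sum>i\<in>I. galg_scale c (f i))"
  by (intro poly_mapping_eqI) (simp add: lookup_sum sum_distrib_left)

text \<open>Supports can shrink by cancellation; summing over fixed larger sets makes bilinearity a
  rearrangement of finite sums.\<close>

lemma galg_mult_eq_sum:
  assumes "finite A" "Poly_Mapping.keys p \<subseteq> A" "finite B" "Poly_Mapping.keys q \<subseteq> B"
  shows "galg_mult W p q =
    (\<Sum>u\<in>A. \<Sum>v\<in>B.
      Poly_Mapping.single (u \<otimes>\<^bsub>W\<^esub> v) (Poly_Mapping.lookup p u * Poly_Mapping.lookup q v))"
proof -
  have "(\<Sum>v\<in>Poly_Mapping.keys q.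
          Poly_Mapping.single (u \<otimes>\<^bsub>W\<^esub> v) (Poly_Mapping.lookup p u * Poly_Mapping.lookup q v)) =
        (\<Sum>v\<in>B. Poly_Mapping.single (u \<otimes>\<^bsub>W\<^esub> v) (Poly_Mapping.lookup p u * Poly_Mapping.lookup q v))"
    for u
    by (rule sum.mono_neutral_left) (use assms in \<open>auto simp: in_keys_iff\<close>)
  moreover have "(\<Sum>u\<in>Poly_Mapping.keys p. \<Sum>v\<in>B.
          Poly_Mapping.single (u \<otimes>\<^bsub>W\<^esub> v) (Poly_Mapping.lookup p u * Poly_Mapping.lookup q v)) =
      (\<Sum>u\<in>A. \<Sum>v\<in>B.
          Poly_Mapping.single (u \<otimes>\<^bsub>W\<^esub> v) (Poly_Mapping.lookup p u * Poly_Mapping.lookup q v))"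
    by (rule sum.mono_neutral_left) (use assms in \<open>auto simp: in_keys_iff\<close>)
  ultimately show ?thesis unfolding galg_mult_def by simp
qed

lemma galg_mult_single:
  "galg_mult W (Poly_Mapping.single u a) (Poly_Mapping.single v b) =
    Poly_Mapping.single (u \<otimes>\<^bsub>W\<^esub> v) (a * b)"
  by (subst galg_mult_eq_sum[where A = "{u}" and B = "{v}"]) auto

lemma galg_mult_add_left: "galg_mult W (p + p') q = galg_mult W p q + galg_mult W p' q"
proof -
  let ?A = "Poly_Mapping.keys p \<union> Poly_Mapping.keys p'"
  have "Poly_Mapping.keys (p + p') \<subseteq> ?A" by (rule keys_add)
  then show ?thesis
    by (simp add: galg_mult_eq_sum[of ?A _ "Poly_Mapping.keys q"] lookup_add single_add
        distrib_right sum.distrib)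
qed

lemma galg_mult_add_right: "galg_mult W p (q + q') = galg_mult W p q + galg_mult W p q'"
proof -
  let ?B = "Poly_Mapping.keys q \<union> Poly_Mapping.keys q'"
  have "Poly_Mapping.keys (q + q') \<subseteq> ?B" by (rule keys_add)
  then show ?thesis
    by (simp add: galg_mult_eq_sum[of "Poly_Mapping.keys p" _ ?B] lookup_add single_add
        distrib_left sum.distrib)
qed

lemma galg_mult_zero_left [simp]: "galg_mult W 0 q = 0"
  by (simp add: galg_mult_def)

lemma galg_mult_zero_right [simp]: "galg_mult W p 0 = 0"
  by (simp add: galg_mult_def)

lemma galg_mult_sum_left: "galg_mult W (\<Sum>i\<in>I. f i) q = (\<Sum>i\<in>I. galg_mult W (f i) q)"
  by (induction I rule: infinite_finite_induct) (auto simp: galg_mult_add_left)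

lemma galg_mult_sum_right: "galg_mult W p (\<Sum>i\<in>I. f i) = (\<Sum>i\<in>I. galg_mult W p (f i))"
  by (induction I rule: infinite_finite_induct) (auto simp: galg_mult_add_right)

lemma keys_galg_scale: "Poly_Mapping.keys (galg_scale c p) \<subseteq> Poly_Mapping.keys p"
  by (auto simp: in_keys_iff)

lemma galg_scale_single: "galg_scale c (Poly_Mapping.single u a) = Poly_Mapping.single u (c * a)"
  by (intro poly_mapping_eqI) (simp add: lookup_single when_def)

lemma galg_mult_scale_left: "galg_mult W (galg_scale c p) q = galg_scale c (galg_mult W p q)"
  by (simp add: galg_mult_eq_sum[OF finite_keys _ finite_keys order.refl] keys_galg_scale
      galg_scale_sum_right galg_scale_single galg_mult_eq_sum[of "Poly_Mapping.keys p" _ "Poly_Mapping.keys q"] mult_ac)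

lemma galg_mult_scale_right: "galg_mult W p (galg_scale c q) = galg_scale c (galg_mult W p q)"
  by (simp add: keys_galg_scale galg_scale_sum_right galg_scale_single
      galg_mult_eq_sum[of "Poly_Mapping.keys p" _ "Poly_Mapping.keys q"] mult_ac)

lemma galg_mult_diff_left: "galg_mult W (p - p') q = galg_mult W p q - galg_mult W p' q"
  by (metis add_diff_cancel_right' diff_add_cancel galg_mult_add_left)

lemma poly_mapping_eq_sum_single:
  "p = (\<Sum>u\<in>Poly_Mapping.keys p. Poly_Mapping.single u (Poly_Mapping.lookup p u))"
proof (rule poly_mapping_eqI)
  fix w
  have "(\<Sum>u\<in>Poly_Mapping.keys p. Poly_Mapping.lookup (Poly_Mapping.single u (Poly_Mapping.lookup p u)) w)
      = (\<Sum>u\<in>Poly_Mapping.keys p. if u = w then Poly_Mapping.lookup p w else 0)"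
    by (intro sum.cong) (auto simp: lookup_single when_def)
  then show "Poly_Mapping.lookup p w = Poly_Mapping.lookup
      (\<Sum>u\<in>Poly_Mapping.keys p. Poly_Mapping.single u (Poly_Mapping.lookup p u)) w"
    by (auto simp: lookup_sum in_keys_iff)
qed

definition galg_of_set :: "'a set \<Rightarrow> 'a \<Rightarrow>\<^sub>0 rat" where
  "galg_of_set A = (\<Sum>w\<in>A. Poly_Mapping.single w 1)"

lemma lookup_galg_of_set:
  "finite A \<Longrightarrow> Poly_Mapping.lookup (galg_of_set A) w = (if w \<in> A then 1 else 0)"
  unfolding galg_of_set_def by (simp add: lookup_sum lookup_single when_def)

lemma keys_galg_of_set: "Poly_Mapping.keys (galg_of_set A) \<subseteq> A"
  using keys_sum[of "\<lambda>w. Poly_Mapping.single w (1::rat)" A] by (auto simp: galg_of_set_def)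

context group
begin

lemma galg_mult_assoc:
  assumes "Poly_Mapping.keys p \<subseteq> carrier G" "Poly_Mapping.keys q \<subseteq> carrier G"
    "Poly_Mapping.keys r \<subseteq> carrier G"
  shows "galg_mult G (galg_mult G p q) r = galg_mult G p (galg_mult G q r)"
proof -
  have "galg_mult G
      (galg_mult G (\<Sum>u\<in>Poly_Mapping.keys p. Poly_Mapping.single u (Poly_Mapping.lookup p u))
        (\<Sum>u\<in>Poly_Mapping.keys q. Poly_Mapping.single u (Poly_Mapping.lookup q u)))
      (\<Sum>u\<in>Poly_Mapping.keys r. Poly_Mapping.single u (Poly_Mapping.lookup r u)) =
    galg_mult G (\<Sum>u\<in>Poly_Mapping.keys p. Poly_Mapping.single u (Poly_Mapping.lookup p u))
      (galg_mult G (\<Sum>u\<in>Poly_Mapping.keys q. Poly_Mapping.single u (Poly_Mapping.lookup q u))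
        (\<Sum>u\<in>Poly_Mapping.keys r. Poly_Mapping.single u (Poly_Mapping.lookup r u)))"
    unfolding galg_mult_sum_left galg_mult_sum_right galg_mult_single
    by (intro sum.cong refl) (use assms in \<open>auto simp: m_assoc subset_iff mult.assoc\<close>)
  then show ?thesis by (simp flip: poly_mapping_eq_sum_single)
qed

lemma galg_mult_one_left:
  assumes "Poly_Mapping.keys p \<subseteq> carrier G"
  shows "galg_mult G (Poly_Mapping.single \<one> 1) p = p"
proof -
  have "galg_mult G (Poly_Mapping.single \<one> 1)
      (\<Sum>u\<in>Poly_Mapping.keys p. Poly_Mapping.single u (Poly_Mapping.lookup p u)) =
      (\<Sum>u\<in>Poly_Mapping.keys p. Poly_Mapping.single u (Poly_Mapping.lookup p u))"
    unfolding galg_mult_sum_right galg_mult_single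
    by (intro sum.cong refl) (use assms in auto)
  then show ?thesis by (simp flip: poly_mapping_eq_sum_single)
qed

text \<open>In u v = w the factor v is forced to be \<open>inv u \<otimes> w\<close>, so product
  formulas become counting problems.\<close>

lemma lookup_galg_mult_of_set:
  assumes "finite A" "A \<subseteq> carrier G" "finite B" "B \<subseteq> carrier G"
  shows "Poly_Mapping.lookup (galg_mult G (galg_of_set A) (galg_of_set B)) w =
    (if w \<in> carrier G then of_nat (card {u \<in> A. inv u \<otimes> w \<in> B}) else 0)"
proof -
  have "Poly_Mapping.lookup (galg_mult G (galg_of_set A) (galg_of_set B)) w =
      (\<Sum>u\<in>A. \<Sum>v\<in>B. if u \<otimes> v = w then 1 else 0)"
    unfolding galg_of_set_def galg_mult_sum_left galg_mult_sum_right galg_mult_single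
    by (simp add: lookup_sum lookup_single when_def) (rule sum.swap)
  also have "\<dots> = (\<Sum>u\<in>A. if w \<in> carrier G \<and> inv u \<otimes> w \<in> B then 1 else 0)"
  proof (rule sum.cong[OF refl])
    fix u assume u: "u \<in> A"
    have "(u \<otimes> v = w) = (w \<in> carrier G \<and> v = inv u \<otimes> w)" if "v \<in> B" for v
    proof -
      have uv: "u \<in> carrier G" "v \<in> carrier G" using that u assms by auto
      show ?thesis using uv
        by (metis inv_closed inv_solve_left m_closed)
    qed
    then have "(\<Sum>v\<in>B. if u \<otimes> v = w then 1 else (0::rat)) =
        (\<Sum>v\<in>B. if v = inv u \<otimes> w then (if w \<in> carrier G then 1 else 0) else 0)"
      by (intro sum.cong) auto
    then show "(\<Sum>v\<in>B. if u \<otimes> v = w then 1 else (0::rat)) =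
        (if w \<in> carrier G \<and> inv u \<otimes> w \<in> B then 1 else 0)"
      using assms by (auto simp: sum.delta)
  qed
  also have "\<dots> = (if w \<in> carrier G then of_nat (card {u \<in> A. inv u \<otimes> w \<in> B}) else 0)"
    using assms(1) by (simp flip: sum.inter_filter)
  finally show ?thesis .
qed

end

section \<open>Words and length in a Coxeter system\<close>

context group
begin

lemma word_prod_Nil [simp]: "word_prod G [] = \<one>"
  by (simp add: word_prod_def)

lemma word_prod_Cons [simp]: "word_prod G (x # xs) = x \<otimes> word_prod G xs"
  by (simp add: word_prod_def)

lemma word_prod_closed [simp]: "set ws \<subseteq> carrier G \<Longrightarrow> word_prod G ws \<in> carrier G"
  by (induction ws) auto

lemma word_prod_append:
  "set us \<subseteq> carrier G \<Longrightarrow> set vs \<subseteq> carrier G \<Longrightarrow>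
    word_prod G (us @ vs) = word_prod G us \<otimes> word_prod G vs"
  by (induction us) (auto simp: m_assoc)

end

locale coxeter = group W for W :: "('a, 'b) monoid_scheme" (structure) +
  fixes S :: "'a set"
  assumes coxeter_system: "coxeter_system W S"
begin

abbreviation len :: "'a \<Rightarrow> nat" where "len \<equiv> coxeter_length W S"

lemma S_closed: "S \<subseteq> carrier W"
  using coxeter_system by (simp add: coxeter_system_def)

lemma gen_closed [simp]: "x \<in> S \<Longrightarrow> x \<in> carrier W"
  using S_closed by blast

lemma word_closed [simp]: "ws \<in> lists S \<Longrightarrow> set ws \<subseteq> carrier W"
  using S_closed by auto

lemma ord_gen: "x \<in> S \<Longrightarrow> ord x = 2"
  using coxeter_system by (simp add: coxeter_system_def)

lemma gen_square [simp]: "x \<in> S \<Longrightarrow> x \<otimes> x = \<one>"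
  using pow_ord_eq_1[of x] by (simp add: ord_gen numeral_2_eq_2)

lemma gen_cancel [simp]: "x \<in> S \<Longrightarrow> w \<in> carrier W \<Longrightarrow> w \<otimes> x \<otimes> x = w"
  by (simp add: m_assoc)

lemma gen_cancel_left [simp]: "x \<in> S \<Longrightarrow> w \<in> carrier W \<Longrightarrow> x \<otimes> (x \<otimes> w) = w"
  by (simp flip: m_assoc)

lemma inv_gen: "x \<in> S \<Longrightarrow> inv x = x"
  by (simp add: inv_equality)

lemma word_prod_eq_iff:
  "us \<in> lists S \<Longrightarrow> vs \<in> lists S \<Longrightarrow>
    word_prod W us = word_prod W vs \<longleftrightarrow> equivclp (coxeter_step W S) us vs"
  using coxeter_system by (simp add: coxeter_system_def)

lemma ex_word:
  assumes "w \<in> carrier W"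
  shows "\<exists>ws\<in>lists S. word_prod W ws = w"
proof -
  have "w \<in> generate W S" using assms coxeter_system by (simp add: coxeter_system_def)
  then show ?thesis
  proof (induction rule: generate.induct)
    case one
    show ?case by (rule bexI[of _ "[]"]) auto
  next
    case (incl h)
    then show ?case by (intro bexI[of _ "[h]"]) auto
  next
    case (inv h)
    then show ?case by (intro bexI[of _ "[h]"]) (auto simp: inv_gen)
  next
    case (eng h1 h2)
    then obtain us vs where "us \<in> lists S" "word_prod W us = h1" "vs \<in> lists S" "word_prod W vs = h2"
      by blast
    then show ?case by (intro bexI[of _ "us @ vs"]) (auto simp: word_prod_append)
  qed
qed

lemma reduced_word:
  assumes "w \<in> carrier W"
  obtains ws where "ws \<in> lists S" "word_prod W ws = w" "length ws = len w"
proof -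
  have "\<exists>k. \<exists>ws\<in>lists S. length ws = k \<and> word_prod W ws = w"
    using ex_word[OF assms] by blast
  then have "\<exists>ws\<in>lists S. length ws = len w \<and> word_prod W ws = w"
    unfolding coxeter_length_def by (rule LeastI_ex)
  then show thesis using that by blast
qed

lemma len_word_prod_le: "ws \<in> lists S \<Longrightarrow> len (word_prod W ws) \<le> length ws"
  unfolding coxeter_length_def by (rule Least_le) blast

lemma len_mult_gen_le:
  assumes "w \<in> carrier W" "x \<in> S"
  shows "len (w \<otimes> x) \<le> len w + 1"
proof -
  obtain ws where "ws \<in> lists S" "word_prod W ws = w" "length ws = len w"
    using reduced_word[OF assms(1)] .
  then show ?thesis using len_word_prod_le[of "ws @ [x]"] assms
    by (auto simp: word_prod_append)
qed

text \<open>All relators have even length.\<close>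

lemma even_length_iff:
  assumes "us \<in> lists S" "vs \<in> lists S" "word_prod W us = word_prod W vs"
  shows "even (length us) \<longleftrightarrow> even (length vs)"
proof -
  have *: "even (length a) \<longleftrightarrow> even (length b)" if "coxeter_step W S a b" for a b
    using that by cases (simp add: length_concat sum_list_replicate)
  have "equivclp (coxeter_step W S) us vs"
    using assms word_prod_eq_iff by blast
  then show ?thesis
    by (induction rule: equivclp_induct) (auto dest: *)
qed

text \<open>Parity rules out equality, so every generator is either an ascent or a descent of
  \<open>w\<close>.\<close>

lemma len_mult_gen_neq:
  assumes "w \<in> carrier W" "x \<in> S"
  shows "len (w \<otimes> x) \<noteq> len w"
proof -
  obtain us where us: "us \<in> lists S" "word_prod W us = w" "length us = len w"
    using reduced_word[OF assms(1)] .
  obtain vs where vs: "vs \<in> lists S" "word_prod W vs = w \<otimes> x" "length vs = len (w \<otimes> x)"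
    using reduced_word[of "w \<otimes> x"] assms by auto
  have "even (length (us @ [x])) \<longleftrightarrow> even (length vs)"
    using us vs assms by (intro even_length_iff) (auto simp: word_prod_append)
  then show ?thesis using us vs by auto
qed

text \<open>The last letter of a reduced word is a descent.\<close>

lemma ex_descent:
  assumes "w \<in> carrier W" "w \<noteq> \<one>"
  shows "\<exists>x\<in>S. len (w \<otimes> x) < len w"
proof -
  obtain ws where ws: "ws \<in> lists S" "word_prod W ws = w" "length ws = len w"
    using reduced_word[OF assms(1)] .
  then have "ws \<noteq> []" using assms by auto
  then obtain vs x where vx: "ws = vs @ [x]" by (metis rev_exhaust)
  then have "x \<in> S" "vs \<in> lists S" using ws by auto
  moreover have "w \<otimes> x = word_prod W vs"
    using ws vx calculation gen_cancel[of x "word_prod W vs"] word_closed[of vs]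
    by (simp add: word_prod_append)
  ultimately show ?thesis using len_word_prod_le[of vs] ws vx by (intro bexI[of _ x]) auto
qed

end

section \<open>The action of type D on signed coordinates\<close>

text \<open>
  The integer \<open>x\<close> stands for the vector \<open>e x\<close>, where \<open>e (- x) = - e x\<close>. The simple root of
  \<open>s i\<close> is \<open>e (hi i) - e (lo i)\<close>. With this choice of signs \<open>hi i = lo j\<close> for each edge \<open>i < j\<close>,
  also at the fork.
\<close>

definition lo :: "nat \<Rightarrow> int" where "lo i = (if i = 1 then -1 else int i - 1)"
definition hi :: "nat \<Rightarrow> int" where "hi i = (if i = 1 then 2 else int i)"

text \<open>The reflection in the simple root of \<open>s i\<close>: for i >= 2 it swaps the
  coordinates i - 1 and i, and for i = 1 it swaps 1 and 2 with a change of sign. At i = 0 the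
  formula degenerates, hence the hypotheses \<open>1 \<le> i\<close> below.\<close>

definition refl_D :: "nat \<Rightarrow> int \<Rightarrow> int" where
  "refl_D i x = (if x = lo i then hi i else if x = hi i then lo i
     else if x = - lo i then - hi i else if x = - hi i then - lo i else x)"

lemma refl_D_minus: "1 \<le> i \<Longrightarrow> refl_D i (- x) = - refl_D i x"
  by (auto simp: refl_D_def lo_def hi_def)

lemma refl_D_refl_D [simp]: "1 \<le> i \<Longrightarrow> refl_D i (refl_D i x) = x"
  by (auto simp: refl_D_def lo_def hi_def)

lemma refl_D_swap [simp]: "refl_D i (lo i) = hi i" "1 \<le> i \<Longrightarrow> refl_D i (hi i) = lo i"
  by (auto simp: refl_D_def lo_def hi_def)

lemma type_D_edge_link: "type_D_edge i j \<Longrightarrow> 1 \<le> i \<and> i < j \<and> hi i = lo j"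
  by (auto simp: lo_def hi_def type_D_edge_def)

text \<open>Up to sign the two reflections act on the three coordinates \<open>lo i\<close>,
  \<open>hi i = lo j\<close>, \<open>hi j\<close> as adjacent transpositions, so these values settle
  the braid relation.\<close>

lemma refl_D_edge:
  assumes "type_D_edge i j"
  shows "refl_D i (lo j) = lo i" "refl_D i (hi j) = hi j" "refl_D j (lo i) = lo i" "refl_D j (hi i) = hi j"
proof -
  consider "i = 1" "j = 3" | "i = 2" "j = 3" | "i \<ge> 3" "j = i + 1"
    using assms unfolding type_D_edge_def by blast
  then have "refl_D i (lo j) = lo i \<and> refl_D i (hi j) = hi j \<and>
      refl_D j (lo i) = lo i \<and> refl_D j (hi i) = hi j"
    by cases (simp_all add: refl_D_def lo_def hi_def)
  then show "refl_D i (lo j) = lo i" "refl_D i (hi j) = hi j" "refl_D j (lo i) = lo i"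
    "refl_D j (hi i) = hi j" by blast+
qed

text \<open>In both alternatives the root of one generator is fixed by the other. The second
  alternative is the pair 1, 2, whose roots e_2 + e_1 and e_2 - e_1 are orthogonal although they
  involve the same coordinates.\<close>

lemma refl_D_non_edge:
  assumes "1 \<le> i" "i < j" "\<not> type_D_edge i j"
  shows "refl_D i (lo j) = lo j \<and> refl_D i (hi j) = hi j \<or>
         refl_D i (lo j) = - hi j \<and> refl_D i (hi j) = - lo j" (is ?i)
    and "refl_D j (lo i) = lo i \<and> refl_D j (hi i) = hi i \<or>
         refl_D j (lo i) = - hi i \<and> refl_D j (hi i) = - lo i" (is ?j)
proof -
  consider "i = 1" "j = 2" | "i = 1" "j \<ge> 4" | "i = 2" "j \<ge> 4" | "i \<ge> 3" "j \<ge> i + 2"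
    using assms unfolding type_D_edge_def by linarith
  then have "?i \<and> ?j"
    by cases (simp_all add: refl_D_def lo_def hi_def)
  then show ?i ?j by blast+
qed

lemma refl_D_fixes:
  "x \<noteq> lo i \<Longrightarrow> x \<noteq> hi i \<Longrightarrow> x \<noteq> - lo i \<Longrightarrow> x \<noteq> - hi i \<Longrightarrow> refl_D i x = x"
  by (simp add: refl_D_def)

lemma refl_D_commute:
  assumes "1 \<le> i" "i < j" "\<not> type_D_edge i j"
  shows "refl_D i (refl_D j x) = refl_D j (refl_D i x)"
proof -
  have j: "1 \<le> j" using assms by simp
  note [simp] = refl_D_minus[OF assms(1)] refl_D_minus[OF j] refl_D_swap(2)[OF assms(1)]
    refl_D_swap(2)[OF j]
  consider "x = lo i \<or> x = hi i \<or> x = - lo i \<or> x = - hi i"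
    | "x = lo j \<or> x = hi j \<or> x = - lo j \<or> x = - hi j"
    | "refl_D i x = x" "refl_D j x = x"
    using refl_D_fixes by metis
  then show ?thesis
  proof cases
    case 1
    then show ?thesis using refl_D_non_edge(2)[OF assms] by (elim disjE conjE) simp_all
  next
    case 2
    then show ?thesis using refl_D_non_edge(1)[OF assms] by (elim disjE conjE) simp_all
  qed simp
qed

lemma refl_D_braid:
  assumes "type_D_edge i j"
  shows "refl_D i (refl_D j (refl_D i x)) = refl_D j (refl_D i (refl_D j x))"
proof -
  have i: "1 \<le> i" and j: "1 \<le> j" and link: "hi i = lo j"
    using type_D_edge_link[OF assms] by auto
  note [simp] = refl_D_minus[OF i] refl_D_minus[OF j] refl_D_swap(2)[OF i]
    refl_D_swap(2)[OF j] refl_D_edge[OF assms]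
  have [simp]: "refl_D i (lo i) = lo j" "refl_D j (lo j) = hi j"
    using link by (metis refl_D_swap(1))+
  consider "x = lo i \<or> x = - lo i" | "x = lo j \<or> x = - lo j" | "x = hi j \<or> x = - hi j"
    | "refl_D i x = x" "refl_D j x = x"
    using refl_D_fixes link by metis
  then show ?thesis by cases (auto simp: link)
qed

lemma refl_D_support:
  assumes "i \<in> {1..n}" "n \<ge> 3" "x \<noteq> 0" "\<bar>x\<bar> \<le> int n"
  shows "refl_D i x \<noteq> 0 \<and> \<bar>refl_D i x\<bar> \<le> int n"
proof -
  have "refl_D i x \<in> {lo i, hi i, - lo i, - hi i, x}"
    by (simp add: refl_D_def)
  moreover have "lo i \<noteq> 0" "hi i \<noteq> 0" "\<bar>lo i\<bar> \<le> int n" "\<bar>hi i\<bar> \<le> int n"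
    using assms by (auto simp: lo_def hi_def)
  ultimately show ?thesis using assms by auto
qed

lemma refl_D_outside:
  assumes "i \<in> {1..n}" "n \<ge> 3" "x = 0 \<or> \<bar>x\<bar> > int n"
  shows "refl_D i x = x"
proof (rule refl_D_fixes)
qed (use assms in \<open>auto simp: lo_def hi_def\<close>)

section \<open>Construction of the action of \<open>W\<close> from its presentation\<close>

locale coxeter_D =
  fixes W :: "('a, 'b) monoid_scheme" (structure) and n :: nat and s :: "nat \<Rightarrow> 'a"
  assumes n3: "n \<ge> 3" and D: "coxeter_system_D W n s"

sublocale coxeter_D \<subseteq> coxeter W "s ` {1..n}"
proof -
  have "coxeter_system W (s ` {1..n})" using D by (simp add: coxeter_system_D_def)
  then show "coxeter W (s ` {1..n})"
    by (simp add: coxeter_def coxeter_axioms_def coxeter_system_def)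
qed

context coxeter_D
begin

declare atLeastAtMost_iff [simp del] One_nat_def [simp del]

lemma index_ge: "i \<in> {1..n} \<Longrightarrow> 1 \<le> i"
  by (simp add: atLeastAtMost_iff)

lemma refl_D_index [simp]:
  "i \<in> {1..n} \<Longrightarrow> refl_D i (refl_D i x) = x"
  "i \<in> {1..n} \<Longrightarrow> refl_D i (hi i) = lo i"
  by (simp_all add: index_ge)

lemma inj_s: "inj_on s {1..n}"
  using D by (simp add: coxeter_system_D_def)

lemma s_in [simp]: "i \<in> {1..n} \<Longrightarrow> s i \<in> s ` {1..n}"
  by blast

lemma s_closed [simp]: "i \<in> {1..n} \<Longrightarrow> s i \<in> carrier W"
  by (rule gen_closed) (rule s_in)

lemma s_pair:
  "i \<in> {1..n} \<Longrightarrow> j \<in> {1..n} \<Longrightarrow> i < j \<Longrightarrow>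
    (if type_D_edge i j then ord (s i \<otimes> s j) = 3 else s i \<otimes> s j = s j \<otimes> s i)"
  using D unfolding coxeter_system_D_def by blast

lemma s_commute:
  "i \<in> {1..n} \<Longrightarrow> j \<in> {1..n} \<Longrightarrow> i < j \<Longrightarrow> \<not> type_D_edge i j \<Longrightarrow> s i \<otimes> s j = s j \<otimes> s i"
  using s_pair[of i j] by simp

lemma ord_edge:
  "i \<in> {1..n} \<Longrightarrow> j \<in> {1..n} \<Longrightarrow> type_D_edge i j \<Longrightarrow> ord (s i \<otimes> s j) = 3"
  using s_pair[of i j] type_D_edge_link[of i j] by simp

lemma ord_swap:
  assumes "i \<in> {1..n}" "j \<in> {1..n}"
  shows "ord (s j \<otimes> s i) = ord (s i \<otimes> s j)"
proof -
  have "s j \<otimes> s i = inv (s i \<otimes> s j)"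
    using assms by (simp add: inv_mult_group inv_gen)
  then show ?thesis using assms by simp
qed

text \<open>Commuting involutions give an order dividing 2; injectivity of \<open>s\<close> excludes
  the order 1.\<close>

lemma ord_commute:
  assumes "i \<in> {1..n}" "j \<in> {1..n}" "i \<noteq> j" "s i \<otimes> s j = s j \<otimes> s i"
  shows "ord (s i \<otimes> s j) = 2"
proof -
  have "(s i \<otimes> s j) \<otimes> (s i \<otimes> s j) = (s i \<otimes> s j) \<otimes> (s j \<otimes> s i)"
    using assms by simp
  also have "\<dots> = \<one>" using assms(1,2) by (simp add: m_assoc)
  finally have "(s i \<otimes> s j) [^] (2::nat) = \<one>"
    using assms by (simp add: numeral_2_eq_2)
  then have "ord (s i \<otimes> s j) dvd 2"
    using assms pow_eq_id[of "s i \<otimes> s j" 2] by simp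
  moreover have "ord (s i \<otimes> s j) \<noteq> 1"
  proof
    assume "ord (s i \<otimes> s j) = 1"
    then have "s i \<otimes> s j = \<one>" using assms ord_eq_1[of "s i \<otimes> s j"] by simp
    then have "s i = s j" using assms gen_cancel[of "s j" "s i"] by simp
    then show False using assms(1-3) inj_onD[OF inj_s] by blast
  qed
  ultimately show ?thesis
    using prime_nat_iff two_is_prime_nat by blast
qed

lemma s_braid:
  assumes "i \<in> {1..n}" "j \<in> {1..n}" "type_D_edge i j"
  shows "s i \<otimes> s j \<otimes> s i = s j \<otimes> s i \<otimes> s j"
proof -
  have "(s i \<otimes> s j) [^] (3::nat) = \<one>"
    using pow_ord_eq_1[of "s i \<otimes> s j"] ord_edge[OF assms] assms by simp
  then have "(s i \<otimes> s j \<otimes> s i) \<otimes> (s j \<otimes> s i \<otimes> s j) = \<one>"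
    using assms by (simp add: numeral_3_eq_3 m_assoc)
  then have "s i \<otimes> s j \<otimes> s i = inv (s j \<otimes> s i \<otimes> s j)"
    using assms by (simp add: inv_equality)
  then show ?thesis using assms by (simp add: inv_mult_group inv_gen m_assoc)
qed

text \<open>Words consist of group elements, not of indices, so the index has to be recovered from
  the generator.\<close>

definition gen_act :: "'a \<Rightarrow> int \<Rightarrow> int" where
  "gen_act x = refl_D (the_inv_into {1..n} s x)"

lemma gen_act_s: "i \<in> {1..n} \<Longrightarrow> gen_act (s i) = refl_D i"
  by (simp add: gen_act_def the_inv_into_f_f[OF inj_s])

definition word_act :: "'a list \<Rightarrow> int \<Rightarrow> int" where
  "word_act ws = foldr (\<lambda>x f. gen_act x \<circ> f) ws id"

lemma word_act_simps [simp]: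
  "word_act [] = id" "word_act (x # ws) = gen_act x \<circ> word_act ws"
  by (simp_all add: word_act_def)

lemma word_act_append: "word_act (us @ vs) = word_act us \<circ> word_act vs"
  by (induction us) auto

lemma word_act_relator:
  assumes "i \<in> {1..n}" "j \<in> {1..n}"
  shows "word_act (concat (replicate (ord (s i \<otimes> s j)) [s i, s j])) = id"
proof (cases "i = j")
  case True
  then have "ord (s i \<otimes> s j) = 1" using assms by simp
  then show ?thesis using True refl_D_refl_D[OF index_ge[OF assms(1)]] assms
    by (simp add: gen_act_s fun_eq_iff replicate_Suc[of 0, folded One_nat_def])
next
  case False
  define p q where "p = min i j" and "q = max i j"
  have pq: "p \<in> {1..n}" "q \<in> {1..n}" "p < q" "i = p \<and> j = q \<or> i = q \<and> j = p"
    using assms False by (auto simp: p_def q_def min_def max_def)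
  have ord_pq: "ord (s i \<otimes> s j) = ord (s p \<otimes> s q)"
    using pq ord_swap by auto
  show ?thesis
  proof (cases "type_D_edge p q")
    case True
    then have 3: "ord (s i \<otimes> s j) = 3" using ord_pq ord_edge pq by simp
    have "refl_D i (refl_D j (refl_D i x)) = refl_D j (refl_D i (refl_D j x))" for x
      using pq(4) refl_D_braid[OF True, of x] by (elim disjE conjE) simp_all
    then show ?thesis using assms unfolding 3 by (simp add: numeral_3_eq_3 gen_act_s fun_eq_iff)
  next
    case False
    then have 2: "ord (s i \<otimes> s j) = 2"
      using ord_pq ord_commute[of p q] s_commute[of p q] pq by simp
    have "refl_D i (refl_D j x) = refl_D j (refl_D i x)" for x
      using pq(4) refl_D_commute[OF index_ge[OF pq(1)] pq(3) False, of x]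
      by (elim disjE conjE) simp_all
    then show ?thesis using assms unfolding 2 by (simp add: numeral_2_eq_2 gen_act_s fun_eq_iff)
  qed
qed

text \<open>This is the universal property of the presentation: relators act trivially, so
  equivalent words act alike.\<close>

lemma word_act_cong:
  assumes "us \<in> lists (s ` {1..n})" "vs \<in> lists (s ` {1..n})" "word_prod W us = word_prod W vs"
  shows "word_act us = word_act vs"
proof -
  have *: "word_act a = word_act b" if "coxeter_step W (s ` {1..n}) a b" for a b
    using that
  proof cases
    case (1 u v x y)
    then obtain i j where "x = s i" "y = s j" "i \<in> {1..n}" "j \<in> {1..n}" by blast
    then show ?thesis using 1 word_act_relator[of i j] by (simp add: word_act_append)
  qed
  have "equivclp (coxeter_step W (s ` {1..n})) us vs"
    using assms word_prod_eq_iff by blast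
  then show ?thesis
    by (induction rule: equivclp_induct) (metis *)+
qed

text \<open>By \<open>word_act_cong\<close> the result is the same for every word that represents
  \<open>w\<close>.\<close>

definition act :: "'a \<Rightarrow> int \<Rightarrow> int" where
  "act w = word_act (SOME ws. ws \<in> lists (s ` {1..n}) \<and> word_prod W ws = w)"

lemma act_word_prod:
  assumes "ws \<in> lists (s ` {1..n})"
  shows "act (word_prod W ws) = word_act ws"
proof -
  let ?P = "\<lambda>vs. vs \<in> lists (s ` {1..n}) \<and> word_prod W vs = word_prod W ws"
  have "?P (SOME vs. ?P vs)" by (rule someI[of ?P ws]) (use assms in simp)
  then show ?thesis unfolding act_def using assms word_act_cong by blast
qed

lemma act_one [simp]: "act \<one> = id"
  using act_word_prod[of "[]"] by simp

lemma act_s [simp]: "i \<in> {1..n} \<Longrightarrow> act (s i) = refl_D i"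
  using act_word_prod[of "[s i]"] by (simp add: gen_act_s)

lemma act_mult [simp]:
  assumes "v \<in> carrier W" "w \<in> carrier W"
  shows "act (v \<otimes> w) x = act v (act w x)"
proof -
  obtain us vs where "us \<in> lists (s ` {1..n})" "word_prod W us = v"
    "vs \<in> lists (s ` {1..n})" "word_prod W vs = w"
    using assms ex_word by blast
  then show ?thesis
    using act_word_prod[of "us @ vs"] act_word_prod[of us] act_word_prod[of vs]
    by (auto simp: word_prod_append word_act_append)
qed

lemma act_inv_act [simp]: "w \<in> carrier W \<Longrightarrow> act (inv w) (act w x) = x"
  using act_mult[of "inv w" w x] by simp

lemma act_act_inv [simp]: "w \<in> carrier W \<Longrightarrow> act w (act (inv w) x) = x"
  using act_mult[of w "inv w" x] by simp

lemma act_eq_iff [simp]: "w \<in> carrier W \<Longrightarrow> act w x = act w y \<longleftrightarrow> x = y"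
  by (metis act_inv_act)

lemma act_induct:
  assumes w: "w \<in> carrier W" and "P id"
    and step: "\<And>i f. i \<in> {1..n} \<Longrightarrow> P f \<Longrightarrow> P (refl_D i \<circ> f)"
  shows "P (act w)"
proof -
  obtain ws where ws: "ws \<in> lists (s ` {1..n})" "word_prod W ws = w"
    using w ex_word by blast
  have "P (word_act ws)" using ws(1)
  proof (induction ws)
    case Nil
    then show ?case using \<open>P id\<close> unfolding word_act_simps by blast
  next
    case (Cons x ws)
    then obtain i where "i \<in> {1..n}" "x = s i" by auto
    then show ?case using Cons step[of i "word_act ws"] unfolding word_act_simps
      by (auto simp: gen_act_s simp del: o_apply)
  qed
  then show ?thesis using act_word_prod[OF ws(1)] ws(2) by simp
qed

lemma act_minus [simp]: "w \<in> carrier W \<Longrightarrow> act w (- x) = - act w x"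
  by (rule act_induct[of w "\<lambda>f. f (- x) = - f x"]) (auto simp: refl_D_minus[OF index_ge])

lemma act_outside: "w \<in> carrier W \<Longrightarrow> x = 0 \<or> \<bar>x\<bar> > int n \<Longrightarrow> act w x = x"
  by (rule act_induct[of w "\<lambda>f. f x = x"]) (auto simp: refl_D_outside[OF _ n3])

definition support :: "int set" where "support = {x. x \<noteq> 0 \<and> \<bar>x\<bar> \<le> int n}"

lemma finite_support: "finite support"
  by (rule finite_subset[of _ "{- int n..int n}"]) (auto simp: support_def atLeastAtMost_iff)

lemma card_support: "card support = 2 * n"
proof -
  have "support = {- int n..int n} - {0}" by (auto simp: support_def atLeastAtMost_iff)
  then show ?thesis by (simp add: card_Diff_singleton atLeastAtMost_iff)
qed

lemma act_support: "w \<in> carrier W \<Longrightarrow> x \<in> support \<Longrightarrow> act w x \<in> support"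
  unfolding support_def
  by (rule act_induct[of w "\<lambda>f. f x \<in> {x. x \<noteq> 0 \<and> \<bar>x\<bar> \<le> int n}"])
    (simp_all add: refl_D_support[OF _ n3])

lemma act_permutes:
  assumes "w \<in> carrier W"
  shows "act w permutes support"
  unfolding permutes_def
  using assms act_outside[OF assms]
  by (auto simp: support_def) (metis act_act_inv)

section \<open>Ascents as positivity of simple roots, and faithfulness of the action\<close>

text \<open>This says that \<open>w\<close> maps the simple root \<open>e (hi i) - e (lo i)\<close> to a positive root.\<close>

definition pos :: "'a \<Rightarrow> nat \<Rightarrow> bool" where
  "pos w i \<longleftrightarrow> act w (lo i) < act w (hi i)"

text \<open>The root of \<open>s i\<close> is orthogonal to that of \<open>s j\<close> and thus
  fixed by \<open>s j\<close>; if its two coordinates are swapped with signs, oddness of the action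
  restores the inequality.\<close>

lemma pos_non_edge:
  assumes "w \<in> carrier W" "i \<in> {1..n}" "j \<in> {1..n}" "i \<noteq> j"
    "\<not> type_D_edge i j" "\<not> type_D_edge j i"
  shows "pos (w \<otimes> s j) i \<longleftrightarrow> pos w i"
proof -
  have "refl_D j (lo i) = lo i \<and> refl_D j (hi i) = hi i \<or>
        refl_D j (lo i) = - hi i \<and> refl_D j (hi i) = - lo i"
  proof (cases "i < j")
    case True
    then show ?thesis by (rule refl_D_non_edge(2)[OF index_ge[OF assms(2)] _ assms(5)])
  next
    case False
    then have "j < i" using assms(4) by simp
    then show ?thesis by (rule refl_D_non_edge(1)[OF index_ge[OF assms(3)] _ assms(6)])
  qed
  moreover have acts: "act (w \<otimes> s j) x = act w (refl_D j x)" for x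
    using assms(1,3) by simp
  ultimately show ?thesis
    unfolding pos_def acts by (elim disjE conjE) (simp_all add: assms(1))
qed

text \<open>With a_i for the root of \<open>s i\<close>, adjacency gives s_j a_i = a_i + a_j and s_i
  s_j a_i = a_j. The two cases of the proof are the orientations of the edge, which decide the end
  at which the roots share a coordinate.\<close>

lemma pos_edge:
  assumes "w \<in> carrier W" "i \<in> {1..n}" "j \<in> {1..n}" "type_D_edge i j \<or> type_D_edge j i"
  shows "pos w i \<Longrightarrow> pos w j \<Longrightarrow> pos (w \<otimes> s j) i"
    and "pos (w \<otimes> s i \<otimes> s j) i \<longleftrightarrow> pos w j"
proof -
  have "refl_D j (lo i) = lo i \<and> refl_D j (hi i) = hi j \<and> refl_D i (hi j) = hi j \<and>
      refl_D i (lo i) = lo j \<and> hi i = lo j \<or>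
    refl_D j (lo i) = lo j \<and> refl_D j (hi i) = hi i \<and> refl_D i (lo j) = lo j \<and>
      refl_D i (hi i) = hi j \<and> hi j = lo i"
    using assms(4)
  proof
    assume e: "type_D_edge i j"
    show ?thesis using refl_D_edge[OF e] type_D_edge_link[OF e] refl_D_swap(1)[of i]
      by (metis (no_types))
  next
    assume e: "type_D_edge j i"
    show ?thesis using refl_D_edge[OF e] type_D_edge_link[OF e] refl_D_swap(2)[OF index_ge[OF assms(2)]]
      by (metis (no_types))
  qed
  moreover have acts: "act (w \<otimes> s j) x = act w (refl_D j x)"
    "act (w \<otimes> s i \<otimes> s j) x = act w (refl_D i (refl_D j x))" for x
    using assms(1-3) by simp_all
  ultimately have "(pos w i \<longrightarrow> pos w j \<longrightarrow> pos (w \<otimes> s j) i) \<and>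
      (pos (w \<otimes> s i \<otimes> s j) i \<longleftrightarrow> pos w j)"
    unfolding pos_def acts by (elim disjE conjE) simp_all
  then show "pos w i \<Longrightarrow> pos w j \<Longrightarrow> pos (w \<otimes> s j) i" "pos (w \<otimes> s i \<otimes> s j) i \<longleftrightarrow> pos w j"
    by blast+
qed

text \<open>
  Split off a descent \<open>s j\<close> of \<open>w\<close> on the right and, if \<open>i\<close> and \<open>j\<close> are adjacent, also \<open>s i\<close>
  if that is a descent of the rest. The remaining factor sends the roots needed to positive ones
  by induction, and the root of \<open>s i\<close> is moved by \<open>s j\<close> or \<open>s i s j\<close> to a sum of them.
\<close>

lemma pos_if_ascent:
  assumes "w \<in> carrier W" "i \<in> {1..n}" "len w < len (w \<otimes> s i)"
  shows "pos w i"
  using assms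
proof (induction "len w" arbitrary: w i rule: less_induct)
  case less
  note w = less.prems(1) and i = less.prems(2)
  show ?case
  proof (cases "w = \<one>")
    case True
    then show ?thesis using i by (auto simp: pos_def lo_def hi_def)
  next
    case False
    then obtain j where j: "j \<in> {1..n}" "len (w \<otimes> s j) < len w"
      using ex_descent[OF w] by blast
    define v where "v = w \<otimes> s j"
    have v: "v \<in> carrier W" "v \<otimes> s j = w" "len v < len w" using w j by (simp_all add: v_def)
    note si = s_in[OF i] and sj = s_in[OF j(1)]
    have lw: "len w = len v + 1"
      using len_mult_gen_le[OF v(1) sj] v(3) unfolding v(2) by linarith
    have lws: "len (w \<otimes> s i) = len w + 1"
      using len_mult_gen_le[OF w si] less.prems(3) by linarith
    have ij: "i \<noteq> j" using less.prems(3) j(2) by (metis less_asym)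
    have vj: "pos v j" using less.hyps[OF v(3) v(1) j(1)] v(3) unfolding v(2) .
    show ?thesis
    proof (cases "type_D_edge i j \<or> type_D_edge j i")
      case False
      have com: "s i \<otimes> s j = s j \<otimes> s i"
      proof (cases "i < j")
        case True
        then show ?thesis using s_commute[OF i j(1)] False by blast
      next
        case ji: False
        then have "j < i" using ij by linarith
        then show ?thesis using s_commute[OF j(1) i, symmetric] False by blast
      qed
      have "w \<otimes> s i = v \<otimes> (s j \<otimes> s i)"
        unfolding v(2)[symmetric] by (rule m_assoc[OF v(1) s_closed[OF j(1)] s_closed[OF i]])
      also have "\<dots> = v \<otimes> s i \<otimes> s j"
        unfolding com[symmetric] by (rule m_assoc[OF v(1) s_closed[OF i] s_closed[OF j(1)], symmetric])
      \<comment> \<open>The left side is \<open>len v + 2\<close>, so \<open>s i\<close> is an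
        ascent of \<open>v\<close>.\<close>
      finally have "len (w \<otimes> s i) \<le> len (v \<otimes> s i) + 1"
        using len_mult_gen_le[OF m_closed[OF v(1) s_closed[OF i]] sj] by metis
      then have "pos v i" using less.hyps[OF v(3) v(1) i] lws lw by linarith
      then show ?thesis using pos_non_edge[OF v(1) i j(1) ij] False unfolding v(2) by blast
    next
      case True
      show ?thesis
      proof (cases "len v < len (v \<otimes> s i)")
        case vi: True
        have "pos v i" by (rule less.hyps[OF v(3) v(1) i vi])
        from pos_edge(1)[OF v(1) i j(1) True this vj] show ?thesis unfolding v(2) .
      next
        case vi: False
        define u where "u = v \<otimes> s i"
        have u: "u \<in> carrier W" "u \<otimes> s i = v" using v(1) i by (simp_all add: u_def)
        have lv: "len v = len u + 1"
          using vi len_mult_gen_neq[OF v(1) si] len_mult_gen_le[OF u(1) si]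
          unfolding u(2) unfolding u_def by linarith
        have braid: "s i \<otimes> s j \<otimes> s i = s j \<otimes> s i \<otimes> s j"
          using True s_braid[OF i j(1)] s_braid[OF j(1) i] by metis
        have "w \<otimes> s i = u \<otimes> (s i \<otimes> s j \<otimes> s i)"
          unfolding v(2)[symmetric] u(2)[symmetric]
          by (simp only: m_assoc u(1) s_closed[OF i] s_closed[OF j(1)] m_closed)
        also have "\<dots> = u \<otimes> s j \<otimes> s i \<otimes> s j"
          unfolding braid by (simp only: m_assoc u(1) s_closed[OF i] s_closed[OF j(1)] m_closed)
        finally have word: "w \<otimes> s i = u \<otimes> s j \<otimes> s i \<otimes> s j" .
        have "len (w \<otimes> s i) \<le> len (u \<otimes> s j) + 2"
          unfolding word
          using len_mult_gen_le[OF m_closed[OF m_closed[OF u(1) s_closed[OF j(1)]] s_closed[OF i]] sj]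
            len_mult_gen_le[OF m_closed[OF u(1) s_closed[OF j(1)]] si] by linarith
        \<comment> \<open>The length of \<open>w \<otimes> s i\<close> is \<open>len u + 3\<close>,
          and only two letters follow \<open>u \<otimes> s j\<close>.\<close>
        then have uj: "len u < len (u \<otimes> s j)" using lws lw lv by linarith
        have "pos u j" by (rule less.hyps[OF _ u(1) j(1) uj]) (use lw lv in linarith)
        then show ?thesis using pos_edge(2)[OF u(1) i j(1) True] unfolding u(2) v(2) by blast
      qed
    qed
  qed
qed

text \<open>If \<open>s i\<close> is not an ascent of \<open>w\<close>, it is one of
  \<open>w \<otimes> s i\<close>, which then keeps the root of \<open>s i\<close> positive; as
  \<open>s i\<close> negates its own root, \<open>w\<close> makes it negative.\<close>

lemma ascent_iff_pos:
  assumes "w \<in> carrier W" "i \<in> {1..n}"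
  shows "len w < len (w \<otimes> s i) \<longleftrightarrow> pos w i"
proof
  assume "pos w i"
  show "len w < len (w \<otimes> s i)"
  proof (rule ccontr)
    assume "\<not> ?thesis"
    then have "len (w \<otimes> s i) < len (w \<otimes> s i \<otimes> s i)"
      using len_mult_gen_neq[of w "s i"] assms by simp
    then have "pos (w \<otimes> s i) i" using assms by (intro pos_if_ascent) auto
    then show False using assms \<open>pos w i\<close> by (simp add: pos_def)
  qed
qed (rule pos_if_ascent[OF assms])

lemma eq_one_if_pos:
  assumes "w \<in> carrier W" "\<And>i. i \<in> {1..n} \<Longrightarrow> pos w i"
  shows "w = \<one>"
proof (rule ccontr)
  assume "w \<noteq> \<one>"
  then obtain i where "i \<in> {1..n}" "len (w \<otimes> s i) < len w"
    using ex_descent[OF assms(1)] by blast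
  then show False using assms ascent_iff_pos[of w i] by auto
qed

text \<open>If v and w act alike, \<open>inv v \<otimes> w\<close> acts trivially, keeps all simple
  roots positive and so has no descent.\<close>

lemma inj_on_act: "inj_on act (carrier W)"
proof (rule inj_onI)
  fix v w assume vw: "v \<in> carrier W" "w \<in> carrier W" "act v = act w"
  have "inv v \<otimes> w = \<one>"
  proof (rule eq_one_if_pos)
    fix i assume "i \<in> {1..n}"
    then show "pos (inv v \<otimes> w) i"
      using vw by (auto simp: pos_def lo_def hi_def simp flip: vw(3))
  qed (use vw in auto)
  then show "v = w" using vw by (metis inv_closed inv_equality inv_inv)
qed

lemma finite_carrier: "finite (carrier W)"
  using finite_imageD[OF finite_subset inj_on_act, of "{p. p permutes support}"]
    finite_permutations[OF finite_support] act_permutes by blast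

end

section \<open>The sets X_J in terms of coordinates\<close>

text \<open>For odd \<open>f\<close> this says that e_q - e_p and e_q + e_p, the positive roots of
  the subsystem on the coordinates 1, ..., k, are all sent to positive roots.\<close>

definition abs_increasing :: "(int \<Rightarrow> int) \<Rightarrow> nat \<Rightarrow> bool" where
  "abs_increasing f k \<longleftrightarrow> (\<forall>p q. 1 \<le> p \<and> p < q \<and> q \<le> int k \<longrightarrow> \<bar>f p\<bar> < f q)"

lemma abs_increasingD: "abs_increasing f k \<Longrightarrow> 1 \<le> p \<Longrightarrow> p < q \<Longrightarrow> q \<le> int k \<Longrightarrow> \<bar>f p\<bar> < f q"
  by (simp add: abs_increasing_def)

lemma abs_increasing_1 [simp]: "abs_increasing f 1"
  by (simp add: abs_increasing_def)

lemma abs_increasing_id: "abs_increasing id k"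
  by (simp add: abs_increasing_def)

lemma abs_increasing_if_steps:
  assumes "\<And>q. 2 \<le> q \<Longrightarrow> q \<le> int k \<Longrightarrow> \<bar>f (q - 1)\<bar> < f q"
  shows "abs_increasing f k"
proof -
  have "q \<le> int k \<longrightarrow> \<bar>f p\<bar> < f q" if "1 \<le> p" "p + 1 \<le> q" for p q
    using that(2)
  proof (induction q rule: int_ge_induct)
    case base
    then show ?case using assms[of "p + 1"] that by simp
  next
    case (step q)
    then show ?case using assms[of "q + 1"] that by auto
  qed
  then show ?thesis unfolding abs_increasing_def by simp
qed

text \<open>The absolute value of f grows strictly with that of its argument, and f is positive from
  2 on. The sign of f 1 is unknown, but both sides fail when |p| = |q|, so the order of 1 and -1 is
  never tested.\<close>

lemma abs_increasing_abs_less_iff: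
  assumes abs_increasing: "abs_increasing f k" and odd: "\<And>x. f (- x) = - f x"
    and "p \<noteq> 0" "\<bar>p\<bar> \<le> int k" "q \<noteq> 0" "\<bar>q\<bar> \<le> int k"
  shows "\<bar>f p\<bar> < f q \<longleftrightarrow> \<bar>p\<bar> < q"
proof -
  have abs: "\<bar>f \<bar>x\<bar>\<bar> = \<bar>f x\<bar>" for x
    by (cases "x \<ge> 0") (auto simp: odd)
  have mono: "\<bar>f x\<bar> < f \<bar>y\<bar>" if "x \<noteq> 0" "\<bar>x\<bar> < \<bar>y\<bar>" "\<bar>y\<bar> \<le> int k" for x y
    using abs_increasingD[OF abs_increasing, of "\<bar>x\<bar>" "\<bar>y\<bar>"] that by (simp add: abs)
  consider "\<bar>p\<bar> < \<bar>q\<bar>" | "\<bar>p\<bar> = \<bar>q\<bar>" | "\<bar>q\<bar> < \<bar>p\<bar>" by linarith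
  then show ?thesis
  proof cases
    case 1
    then have "\<bar>f p\<bar> < f \<bar>q\<bar>" using mono assms by blast
    then show ?thesis using 1 by (cases "q \<ge> 0") (auto simp: odd)
  next
    case 2
    then have "\<bar>f p\<bar> = \<bar>f q\<bar>" using abs by metis
    then show ?thesis using 2 by linarith
  next
    case 3
    then have "\<bar>f q\<bar> < f \<bar>p\<bar>" using mono assms by blast
    then have "\<bar>f q\<bar> < \<bar>f p\<bar>" using abs[of p] by linarith
    then show ?thesis using 3 by linarith
  qed
qed

context coxeter_D
begin

text \<open>The roots 2, ..., k give w 1 < ... < w k and root 1 gives - w 1 < w 2, so |w 1| < w 2
  and all later values are positive. At k = 1 the equivalence breaks down, since root 1 involves
  coordinate 2; hence the special meaning of x_1.\<close>

lemma abs_increasing_iff_pos: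
  assumes w: "w \<in> carrier W" and "2 \<le> k"
  shows "(\<forall>i\<in>{1..k}. pos w i) \<longleftrightarrow> abs_increasing (act w) k"
proof
  assume *: "\<forall>i\<in>{1..k}. pos w i"
  have step: "act w (int m) < act w (int (Suc m))" if "1 \<le> m" "Suc m \<le> k" for m
  proof -
    have "pos w (Suc m)" using * that by (simp add: atLeastAtMost_iff)
    then show ?thesis using that(1) by (simp add: pos_def lo_def hi_def)
  qed
  have "pos w 1" using * assms(2) by (simp add: atLeastAtMost_iff)
  then have "- act w 1 < act w 2" using w by (simp add: pos_def lo_def hi_def)
  then have 2: "\<bar>act w 1\<bar> < act w 2" using step[of 1] assms by simp
  have "Suc m \<le> k \<longrightarrow> \<bar>act w (int m)\<bar> < act w (int (Suc m))" if "1 \<le> m" for m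
    using that
  proof (induction m rule: nat_induct_at_least)
    case base
    then show ?case using 2 by simp
  next
    case (Suc m)
    then show ?case using step[of "Suc m"] by auto
  qed
  note steps = this
  show "abs_increasing (act w) k"
  proof (rule abs_increasing_if_steps)
    fix q assume "2 \<le> q" "q \<le> int k"
    then show "\<bar>act w (q - 1)\<bar> < act w q"
      using steps[of "nat (q - 1)"] by (simp add: nat_diff_distrib le_nat_iff)
  qed
next
  assume ch: "abs_increasing (act w) k"
  show "\<forall>i\<in>{1..k}. pos w i"
  proof
    fix i assume i: "i \<in> {1..k}"
    show "pos w i"
    proof (cases "i = 1")
      case True
      then show ?thesis using abs_increasingD[OF ch, of 1 2] assms by (simp add: pos_def lo_def hi_def)
    next
      case False
      then show ?thesis using abs_increasingD[OF ch, of "int i - 1" "int i"] i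
        by (simp add: pos_def lo_def hi_def atLeastAtMost_iff)
    qed
  qed
qed

end

section \<open>The elements x and their products\<close>

context coxeter_D
begin

definition X_D :: "nat \<Rightarrow> 'a set" where
  "X_D k = {w \<in> carrier W. abs_increasing (act w) k}"

lemma X_D_subset: "X_D k \<subseteq> carrier W"
  by (auto simp: X_D_def)

lemma finite_X: "finite (X_D k)"
  using finite_subset[OF X_D_subset finite_carrier] .

lemma X_D_1: "X_D 1 = carrier W"
  by (simp add: X_D_def)

lemma X_D_n: "X_D n = {\<one>}"
proof -
  have "w = \<one>" if "w \<in> X_D n" for w
    using that abs_increasing_iff_pos[of w n] n3 by (intro eq_one_if_pos) (auto simp: X_D_def)
  then show ?thesis by (auto simp: X_D_def abs_increasing_id)
qed

lemma coxeter_X_eq: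
  assumes "2 \<le> k" "k \<le> n"
  shows "coxeter_X W (s ` {1..n}) (s ` {1..k}) = X_D k"
proof -
  have "(\<forall>x\<in>s ` {1..k}. len (w \<otimes> x) > len w) \<longleftrightarrow> abs_increasing (act w) k" if "w \<in> carrier W" for w
  proof -
    have "(\<forall>x\<in>s ` {1..k}. len (w \<otimes> x) > len w) \<longleftrightarrow> (\<forall>i\<in>{1..k}. pos w i)"
      unfolding ball_simps(9)
      by (intro ball_cong refl ascent_iff_pos[OF that]) (use assms in \<open>simp add: atLeastAtMost_iff\<close>)
    then show ?thesis using abs_increasing_iff_pos[OF that assms(1)] by simp
  qed
  then show ?thesis by (auto simp: coxeter_X_def X_D_def)
qed

abbreviation x :: "nat \<Rightarrow> 'a \<Rightarrow>\<^sub>0 rat" where "x \<equiv> x_D W n s"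

lemma x_eq: "1 \<le> k \<Longrightarrow> k \<le> n \<Longrightarrow> x k = galg_of_set (X_D k)"
  by (cases "k = 1")
    (simp_all add: x_D_def coxeter_x_def galg_of_set_def coxeter_X_eq X_D_1, simp add: coxeter_X_def)

lemma x_0: "x 0 = galg_scale 2 (x 1)"
  by (simp add: x_D_def)

section \<open>Coset representatives for the stabilizer of the coordinate n\<close>

text \<open>The generators lead from n down to 2 and 1, then \<open>s 1\<close> sends 2 to -1, and
  from there the path continues to -n.\<close>

lemma ex_act_eq:
  assumes "e \<in> support"
  shows "\<exists>w\<in>carrier W. act w (int n) = e"
proof -
  define Orb where "Orb = {e. \<exists>w\<in>carrier W. act w (int n) = e}"
  have n: "int n \<in> Orb" unfolding Orb_def by (auto intro: bexI[of _ \<one>])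
  have refl: "refl_D i e \<in> Orb" if i: "i \<in> {1..n}" and e: "e \<in> Orb" for i e
  proof -
    obtain w where w: "w \<in> carrier W" "act w (int n) = e"
      using e unfolding Orb_def mem_Collect_eq by (elim bexE)
    then have "act (s i \<otimes> w) (int n) = refl_D i e"
      using i by simp
    moreover have "s i \<otimes> w \<in> carrier W" using i w(1) by simp
    ultimately show ?thesis unfolding Orb_def mem_Collect_eq by (rule bexI)
  qed
  have down: "int m \<in> Orb" if "1 \<le> m" "m \<le> n" for m
    using that(2,1)
  proof (induction m rule: inc_induct)
    case (step m)
    then have "refl_D (Suc m) (int (Suc m)) = int m"
      using refl_D_swap(2)[of "Suc m"] by (simp add: lo_def hi_def)
    then show ?case using refl[of "Suc m" "int (Suc m)"] step by (simp add: atLeastAtMost_iff)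
  qed (rule n)
  have up: "- int m \<in> Orb" if "1 \<le> m" "m \<le> n" for m
    using that
  proof (induction m rule: nat_induct_at_least)
    case base
    have "refl_D 1 2 = -1" using refl_D_swap(2)[of 1] by (simp add: lo_def hi_def)
    then show ?case using refl[of 1 2] down[of 2] n3 by (simp add: atLeastAtMost_iff)
  next
    case (Suc m)
    have "refl_D (Suc m) (int m) = int (Suc m)"
      using refl_D_swap(1)[of "Suc m"] Suc by (simp add: lo_def hi_def)
    then have "refl_D (Suc m) (- int m) = - int (Suc m)"
      using refl_D_minus[of "Suc m" "int m"] by simp
    then show ?case using refl[of "Suc m" "- int m"] Suc by (simp add: atLeastAtMost_iff)
  qed
  have "e \<in> Orb"
    using down[of "nat e"] up[of "nat (- e)"] assms by (cases "e > 0") (auto simp: support_def)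
  then show ?thesis by (simp add: Orb_def)
qed

text \<open>The witness is an element of minimal length among those that send \<open>n\<close> to \<open>e\<close>.\<close>

lemma ex_X_act_eq:
  assumes "e \<in> support"
  shows "\<exists>c\<in>X_D (n - 1). act c (int n) = e"
proof -
  let ?P = "\<lambda>w. w \<in> carrier W \<and> act w (int n) = e"
  obtain c where c: "?P c" "\<And>w. ?P w \<Longrightarrow> len c \<le> len w"
    using ex_act_eq[OF assms] ex_has_least_nat[of ?P _ len] by blast
  have "pos c i" if i: "i \<in> {1..n - 1}" for i
  proof -
    have i': "i \<in> {1..n}" using i by (auto simp: atLeastAtMost_iff)
    \<comment> \<open>Since \<open>s i\<close> fixes n, \<open>c \<otimes> s i\<close> also sends n
      to \<open>e\<close> and competes with \<open>c\<close> for minimal length.\<close>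
    have "refl_D i (int n) = int n"
      using i n3 by (intro refl_D_fixes) (auto simp: lo_def hi_def atLeastAtMost_iff)
    then have "len c \<le> len (c \<otimes> s i)" using c i' by (intro c(2)) simp
    then show ?thesis
      using ascent_iff_pos[of c i] len_mult_gen_neq[of c "s i"] c i' by simp
  qed
  then have "c \<in> X_D (n - 1)"
    using abs_increasing_iff_pos[of c "n - 1"] c n3 by (auto simp: X_D_def)
  then show ?thesis using c by blast
qed

text \<open>Put f = c^-1 u, so that c f = u and f r = n. Away from r and -r the values of f lie
  strictly between -n and n, where c preserves and reflects the relation |a| < b; there f and u pass
  the same tests. The extreme value n is admissible only at the last place k or beyond it.\<close>

lemma abs_increasing_quotient_iff:
  assumes c: "c \<in> X_D (n - 1)" and u: "u \<in> carrier W" and k: "2 \<le> k" "k \<le> n"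
    and r: "r \<in> support" "act u r = act c (int n)"
  shows "abs_increasing (act (inv c \<otimes> u)) k \<longleftrightarrow>
    int k < \<bar>r\<bar> \<and> abs_increasing (act u) k \<or> r = int k \<and> abs_increasing (act u) (k - 1)"
proof -
  define f where "f = act (inv c \<otimes> u)"
  have cc: "c \<in> carrier W" and cchain: "abs_increasing (act c) (n - 1)" using c by (auto simp: X_D_def)
  have icu: "inv c \<otimes> u \<in> carrier W" using cc u by simp
  have fr: "f r = int n" unfolding f_def using cc u r by simp
  have f_minus: "f (- p) = - f p" for p using icu by (simp add: f_def)
  have f_eq: "act c (f p) = act u p" for p unfolding f_def using cc u by simp
  have f_inj: "f p = f q \<longleftrightarrow> p = q" for p q using icu by (simp add: f_def)
  have f_supp: "f p \<noteq> 0 \<and> \<bar>f p\<bar> \<le> int n" if "p \<in> support" for p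
    using act_support[OF icu that] by (simp add: f_def support_def)
  have f_less: "\<bar>f p\<bar> < int n" if "p \<in> support" "\<bar>p\<bar> \<noteq> \<bar>r\<bar>" for p
  proof -
    have "f p \<noteq> f r" "f p \<noteq> f (- r)" using that f_inj by (metis, metis abs_minus)
    then show ?thesis using f_supp[OF that(1)] fr f_minus by auto
  qed
  have eq: "\<bar>f p\<bar> < f q \<longleftrightarrow> \<bar>act u p\<bar> < act u q"
    if "p \<in> support" "q \<in> support" "\<bar>p\<bar> \<noteq> \<bar>r\<bar>" "\<bar>q\<bar> \<noteq> \<bar>r\<bar>" for p q
    using abs_increasing_abs_less_iff[OF cchain act_minus[OF cc], of "f p" "f q"]
      f_less[of p] f_less[of q] f_supp[of p] f_supp[of q] that unfolding f_eq by simp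
  have in_supp: "p \<in> support" if "1 \<le> p" "p \<le> int k" for p
    using that k by (simp add: support_def)
  have abs_increasing_eq: "abs_increasing f m \<longleftrightarrow> abs_increasing (act u) m" if "int m < \<bar>r\<bar>" "m \<le> k" for m
  proof -
    have "\<bar>f p\<bar> < f q \<longleftrightarrow> \<bar>act u p\<bar> < act u q" if "1 \<le> p" "p < q" "q \<le> int m" for p q
      by (rule eq) (use that \<open>int m < \<bar>r\<bar>\<close> \<open>m \<le> k\<close> in \<open>auto intro!: in_supp\<close>)
    then show ?thesis unfolding abs_increasing_def by blast
  qed
  consider "int k < \<bar>r\<bar>" | "r = int k" | "r = - int k" | "\<bar>r\<bar> < int k" by linarith
  then have "abs_increasing f k \<longleftrightarrow> int k < \<bar>r\<bar> \<and> abs_increasing (act u) k \<or> r = int k \<and> abs_increasing (act u) (k - 1)"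
  proof cases
    case 1
    then show ?thesis using abs_increasing_eq[of k] by auto
  next
    case 2
    have "abs_increasing f k \<longleftrightarrow> abs_increasing f (k - 1)"
    proof
      assume "abs_increasing f k"
      then show "abs_increasing f (k - 1)" unfolding abs_increasing_def using k by auto
    next
      assume ch: "abs_increasing f (k - 1)"
      show "abs_increasing f k" unfolding abs_increasing_def
      proof (intro allI impI)
        fix p q assume pq: "1 \<le> p \<and> p < q \<and> q \<le> int k"
        show "\<bar>f p\<bar> < f q"
        proof (cases "q = int k")
          case True
          then show ?thesis using f_less[OF in_supp, of p] pq 2 fr by simp
        next
          case False
          then show ?thesis using abs_increasingD[OF ch, of p q] pq k by (simp add: of_nat_diff)
        qed
      qed
    qed
    also have "\<dots> \<longleftrightarrow> abs_increasing (act u) (k - 1)"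
      by (rule abs_increasing_eq) (use 2 k in auto)
    finally show ?thesis using 2 by simp
  next
    case 3
    \<comment> \<open>The smallest value stands at place k, which violates a condition because k >=
      2; at k = 1 there would be none.\<close>
    then have "f (int k) = - int n" using fr f_minus[of r] by simp
    then have "\<not> \<bar>f 1\<bar> < f (int k)" by simp
    then have "\<not> abs_increasing f k" using abs_increasingD[of f k 1 "int k"] k by auto
    then show ?thesis using 3 k by simp
  next
    case 4
    have "r \<noteq> 0" using r(1) by (simp add: support_def)
    then have r1: "1 \<le> \<bar>r\<bar>" by linarith
    have "\<bar>f \<bar>r\<bar>\<bar> = int n" using fr f_minus[of r] by (cases "r \<ge> 0") auto
    then have "\<not> \<bar>f \<bar>r\<bar>\<bar> < f (int k)" using f_supp[OF in_supp, of "int k"] k by auto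
    then have "\<not> abs_increasing f k" using abs_increasingD[of f k "\<bar>r\<bar>" "int k"] 4 r1 by auto
    then show ?thesis using 4 by auto
  qed
  then show ?thesis by (simp add: f_def)
qed

lemma bij_betw_X_support:
  assumes u: "u \<in> carrier W"
  shows "bij_betw (\<lambda>c. act (inv u \<otimes> c) (int n)) (X_D (n - 1)) support"
  unfolding bij_betw_def
proof
  have n_supp: "int n \<in> support" using n3 by (simp add: support_def)
  show "inj_on (\<lambda>c. act (inv u \<otimes> c) (int n)) (X_D (n - 1))"
  proof (rule inj_onI)
    fix c d assume cd: "c \<in> X_D (n - 1)" "d \<in> X_D (n - 1)"
      "act (inv u \<otimes> c) (int n) = act (inv u \<otimes> d) (int n)"
    have car: "c \<in> carrier W" "d \<in> carrier W" using cd X_D_subset by auto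
    then have "act d (int n) = act c (int n)" using cd(3) u by simp
    \<comment> \<open>The quotient criterion with k = r = n: membership of d in
      \<open>X_D (n - 1)\<close> lifts to membership of the quotient in \<open>X_D n\<close>, which
      is trivial.\<close>
    then have "abs_increasing (act (inv c \<otimes> d)) n"
      using abs_increasing_quotient_iff[OF cd(1) car(2) _ order.refl n_supp] cd(2) n3 by (simp add: X_D_def)
    then have "inv c \<otimes> d \<in> X_D n" using car by (simp add: X_D_def)
    then have "inv c \<otimes> d = \<one>" by (simp add: X_D_n)
    then show "c = d" using car by (metis inv_closed inv_equality inv_inv)
  qed
  show "(\<lambda>c. act (inv u \<otimes> c) (int n)) ` X_D (n - 1) = support"
  proof
    show "(\<lambda>c. act (inv u \<otimes> c) (int n)) ` X_D (n - 1) \<subseteq> support"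
      using act_support[OF _ n_supp] X_D_subset u by blast
    show "support \<subseteq> (\<lambda>c. act (inv u \<otimes> c) (int n)) ` X_D (n - 1)"
    proof
      fix r assume "r \<in> support"
      then obtain c where c: "c \<in> X_D (n - 1)" "act c (int n) = act u r"
        using ex_X_act_eq[OF act_support[OF u]] by blast
      moreover have "c \<in> carrier W" using c(1) X_D_subset by blast
      ultimately have "act (inv u \<otimes> c) (int n) = r" using u by simp
      then show "r \<in> (\<lambda>c. act (inv u \<otimes> c) (int n)) ` X_D (n - 1)" using c(1) by blast
    qed
  qed
qed

lemma card_quotients:
  assumes u: "u \<in> carrier W" and k: "2 \<le> k" "k \<le> n"
  shows "card {c \<in> X_D (n - 1). inv c \<otimes> u \<in> X_D k} =
    (if u \<in> X_D k then 2 * (n - k) else 0) + (if u \<in> X_D (k - 1) then 1 else 0)"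
proof -
  let ?\<phi> = "\<lambda>c. act (inv u \<otimes> c) (int n)"
  let ?Q = "\<lambda>r. int k < \<bar>r\<bar> \<and> u \<in> X_D k \<or> r = int k \<and> u \<in> X_D (k - 1)"
  have bij: "bij_betw ?\<phi> (X_D (n - 1)) support" by (rule bij_betw_X_support[OF u])
  have mem: "inv c \<otimes> u \<in> X_D k \<longleftrightarrow> ?Q (?\<phi> c)" if c: "c \<in> X_D (n - 1)" for c
  proof -
    have cc: "c \<in> carrier W" using c X_D_subset by blast
    have "?\<phi> c \<in> support" using bij c by (auto simp: bij_betw_def)
    moreover have "act u (?\<phi> c) = act c (int n)" using u cc by simp
    ultimately show ?thesis
      using abs_increasing_quotient_iff[OF c u k, of "?\<phi> c"] u cc by (simp add: X_D_def)
  qed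
  have image: "?\<phi> ` {c \<in> X_D (n - 1). inv c \<otimes> u \<in> X_D k} = {r \<in> support. ?Q r}"
  proof -
    have image: "f ` {c \<in> A. Q (f c)} = {r \<in> f ` A. Q r}" for f :: "'a \<Rightarrow> int" and A Q
      by blast
    have "{c \<in> X_D (n - 1). inv c \<otimes> u \<in> X_D k} = {c \<in> X_D (n - 1). ?Q (?\<phi> c)}"
      by (rule Collect_cong) (use mem in metis)
    moreover have "?\<phi> ` {c \<in> X_D (n - 1). ?Q (?\<phi> c)} = {r \<in> ?\<phi> ` X_D (n - 1). ?Q r}"
      by (rule image)
    moreover have "?\<phi> ` X_D (n - 1) = support" using bij by (rule bij_betw_imp_surj_on)
    ultimately show ?thesis by (simp only:)
  qed
  have inj: "inj_on ?\<phi> {c \<in> X_D (n - 1). inv c \<otimes> u \<in> X_D k}"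
    using bij unfolding bij_betw_def by (auto intro: inj_on_subset)
  have "card {c \<in> X_D (n - 1). inv c \<otimes> u \<in> X_D k} = card {r \<in> support. ?Q r}"
    using card_image[OF inj, symmetric] unfolding image .
  also have "{r \<in> support. ?Q r} =
      (if u \<in> X_D k then {- int n..- int k - 1} \<union> {int k + 1..int n} else {}) \<union>
      (if u \<in> X_D (k - 1) then {int k} else {})"
    using k by (auto simp: support_def atLeastAtMost_iff)
  also have "card \<dots> = card (if u \<in> X_D k then {- int n..- int k - 1} \<union> {int k + 1..int n} else {}) +
      card (if u \<in> X_D (k - 1) then {int k} else {})"
    by (rule card_Un_disjoint) (auto simp: atLeastAtMost_iff)
  also have "card ({- int n..- int k - 1} \<union> {int k + 1..int n}) = 2 * (n - k)"
    using k by (subst card_Un_disjoint) (auto simp: atLeastAtMost_iff)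
  then have "card (if u \<in> X_D k then {- int n..- int k - 1} \<union> {int k + 1..int n} else {}) =
      (if u \<in> X_D k then 2 * (n - k) else 0)" by simp
  finally show ?thesis by simp
qed

lemma card_X: "card (X_D (n - 1)) = 2 * n"
  using bij_betw_same_card[OF bij_betw_X_support[OF one_closed]] card_support by simp

abbreviation mult (infixl "\<odot>" 70) where "p \<odot> q \<equiv> galg_mult W p q"

lemma x_mult_ge2:
  assumes k: "2 \<le> k" "k \<le> n"
  shows "x (n - 1) \<odot> x k = galg_scale (of_nat (2 * (n - k))) (x k) + x (k - 1)"
proof (rule poly_mapping_eqI)
  fix w
  have xs: "x (n - 1) = galg_of_set (X_D (n - 1))" "x k = galg_of_set (X_D k)"
    "x (k - 1) = galg_of_set (X_D (k - 1))"
    using k n3 by (auto intro!: x_eq)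
  show "Poly_Mapping.lookup (x (n - 1) \<odot> x k) w =
      Poly_Mapping.lookup (galg_scale (of_nat (2 * (n - k))) (x k) + x (k - 1)) w"
  proof (cases "w \<in> carrier W")
    case True
    then show ?thesis
      by (simp add: xs lookup_galg_mult_of_set finite_X X_D_subset lookup_add lookup_galg_of_set
          card_quotients[OF True k])
  next
    case False
    then have "w \<notin> X_D m" for m using X_D_subset by blast
    then show ?thesis using False
      by (simp add: xs lookup_galg_mult_of_set finite_X X_D_subset lookup_add lookup_galg_of_set)
  qed
qed

lemma x_mult_1: "x (n - 1) \<odot> x 1 = galg_scale (of_nat (2 * n)) (x 1)"
proof (rule poly_mapping_eqI)
  fix w
  have xs: "x (n - 1) = galg_of_set (X_D (n - 1))" "x 1 = galg_of_set (X_D 1)"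
    using n3 by (auto intro!: x_eq)
  have "{u \<in> X_D (n - 1). inv u \<otimes> w \<in> carrier W} = X_D (n - 1)" if "w \<in> carrier W"
    using that X_D_subset by auto
  then show "Poly_Mapping.lookup (x (n - 1) \<odot> x 1) w =
      Poly_Mapping.lookup (galg_scale (of_nat (2 * n)) (x 1)) w"
    by (simp add: xs lookup_galg_mult_of_set finite_X X_D_subset lookup_galg_of_set card_X)
      (simp add: X_D_1 card_X)
qed

section \<open>Expansion of products of falling factorials\<close>

text \<open>The reversed index p is the number of factors in a (a - 2) ... (a - 2 (p - 1)), where a
  = x_{n-1}. The value 0 beyond n is the true one, since a x_0 = 2n x_0.\<close>

definition y :: "nat \<Rightarrow> 'a \<Rightarrow>\<^sub>0 rat" where
  "y p = (if p \<le> n then x (n - p) else 0)"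

lemma y_recursion: "x (n - 1) \<odot> y p = galg_scale (of_nat (2 * p)) (y p) + y (Suc p)"
proof -
  consider "n - p \<ge> 2" | "Suc p = n" | "p = n" | "p > n" by linarith
  then show ?thesis
  proof cases
    case 1
    then have "n - p - 1 = n - Suc p" "n - (n - p) = p" "p \<le> n" "Suc p \<le> n" by auto
    then show ?thesis using x_mult_ge2[of "n - p"] 1 by (simp add: y_def)
  next
    case 2
    then have p: "p = n - 1" "n - p = 1" "1 \<le> n" by auto
    have "x (n - 1) \<odot> x 1 = galg_scale (of_nat (2 * p)) (x 1) + galg_scale 2 (x 1)"
      unfolding x_mult_1 galg_scale_add_left[symmetric] using p by (simp add: of_nat_diff)
    then show ?thesis using 2 p(2) x_0 by (simp add: y_def)
  next
    case 3
    then show ?thesis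
      by (simp add: y_def x_0 galg_mult_scale_right x_mult_1 galg_scale_scale mult.commute)
  next
    case 4
    then show ?thesis by (simp add: y_def)
  qed
qed

lemma keys_x: "k \<le> n \<Longrightarrow> Poly_Mapping.keys (x k) \<subseteq> carrier W"
  using keys_galg_of_set[of "X_D k"] keys_galg_of_set[of "X_D 1"] X_D_subset n3 keys_galg_scale[of 2 "x 1"]
  by (cases "k = 0") (force simp: x_0 x_eq)+

lemma keys_y: "Poly_Mapping.keys (y p) \<subseteq> carrier W"
  by (simp add: y_def keys_x)

lemma y_0: "y 0 = Poly_Mapping.single \<one> 1"
  using n3 x_eq[of n] by (simp add: y_def X_D_n galg_of_set_def)

text \<open>Multiplying by a - 2p raises p by one. On \<open>y (p + q - i)\<close> this factor is (a
  - 2 (p + q - i)) + 2 (q - i): the first part raises the index, the second yields the new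
  coefficient.\<close>

lemma y_mult:
  "y p \<odot> y q = (\<Sum>i\<le>q. galg_scale (of_nat ((p choose i) * (q choose i) * fact i * 2 ^ i)) (y (p + q - i)))"
proof (induction p)
  case 0
  have "(\<Sum>i\<le>q. galg_scale (of_nat ((0 choose i) * (q choose i) * fact i * 2 ^ i)) (y (0 + q - i))) =
      (\<Sum>i\<le>q. if i = 0 then y q else 0)"
    by (intro sum.cong) (auto simp: binomial_eq_0)
  then show ?case by (simp add: y_0 galg_mult_one_left[OF keys_y] sum.delta)
next
  case (Suc p)
  define c where "c = (\<lambda>p i. (p choose i) * (q choose i) * fact i * 2 ^ i :: nat)"
  have absorb: "Suc i * (q choose Suc i) = (q - i) * (q choose i)" for i
    by (simp only: binomial_absorption binomial_absorb_comp)
  \<comment> \<open>Pascal's rule in p, with \<open>absorb\<close> turning the extra factor i + 1 of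
    the factorial into q - i.\<close>
  have c_rec: "c (Suc p) (Suc i) = c p (Suc i) + 2 * (q - i) * c p i" for i
  proof -
    have "c (Suc p) (Suc i) = c p (Suc i) + (p choose i) * (Suc i * (q choose Suc i)) * fact i * 2 ^ Suc i"
      by (simp add: c_def algebra_simps)
    then show ?thesis unfolding absorb by (simp add: c_def algebra_simps)
  qed
  have c_0: "c p 0 = c (Suc p) 0" by (simp add: c_def)
  have "y (Suc p) = x (n - 1) \<odot> y p - galg_scale (of_nat (2 * p)) (y p)"
    by (simp add: y_recursion)
  then have "y (Suc p) \<odot> y q = x (n - 1) \<odot> (y p \<odot> y q) - galg_scale (of_nat (2 * p)) (y p \<odot> y q)"
    by (simp add: galg_mult_diff_left galg_mult_scale_left galg_mult_assoc keys_y keys_x)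
  also have "\<dots> = (\<Sum>i\<le>q. galg_scale (of_nat (c (Suc p) i)) (y (Suc p + q - i)))"
  proof (rule poly_mapping_eqI)
    fix w
    define t where "t = (\<lambda>i. Poly_Mapping.lookup (y i) w)"
    have "Poly_Mapping.lookup (x (n - 1) \<odot> (y p \<odot> y q) - galg_scale (of_nat (2 * p)) (y p \<odot> y q)) w =
        (\<Sum>i\<le>q. of_nat (c p i) * (of_nat (2 * (p + q - i)) * t (p + q - i) + t (Suc (p + q - i)))) -
        of_nat (2 * p) * (\<Sum>i\<le>q. of_nat (c p i) * t (p + q - i))"
      unfolding Suc.IH by (simp add: galg_mult_sum_right galg_mult_scale_right y_recursion
          lookup_minus lookup_sum lookup_add t_def c_def)
    also have "\<dots> = (\<Sum>i\<le>q. of_nat (c p i) * t (Suc p + q - i) +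
        of_nat (2 * (q - i) * c p i) * t (p + q - i))"
      unfolding sum_distrib_left sum_subtractf[symmetric]
      by (intro sum.cong) (auto simp: of_nat_diff Suc_diff_le algebra_simps)
    also have "\<dots> = (\<Sum>i\<le>q. of_nat (c p i) * t (Suc p + q - i)) +
        (\<Sum>i\<le>q. of_nat (2 * (q - i) * c p i) * t (p + q - i))"
      by (rule sum.distrib)
    \<comment> \<open>The term i = q vanishes, so this sum lines up with the other one after a shift
      of its index.\<close>
    also have "(\<Sum>i\<le>q. of_nat (2 * (q - i) * c p i) * t (p + q - i)) =
        (\<Sum>i<q. of_nat (2 * (q - i) * c p i) * t (p + q - i))"
      by (intro sum.mono_neutral_right) auto
    also have "(\<Sum>i\<le>q. of_nat (c p i) * t (Suc p + q - i)) = of_nat (c p 0) * t (Suc p + q) +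
        (\<Sum>i<q. of_nat (c p (Suc i)) * t (p + q - i))"
      by (subst sum.atMost_shift) simp
    also have "of_nat (c p 0) * t (Suc p + q) + (\<Sum>i<q. of_nat (c p (Suc i)) * t (p + q - i)) +
        (\<Sum>i<q. of_nat (2 * (q - i) * c p i) * t (p + q - i)) =
        of_nat (c (Suc p) 0) * t (Suc p + q) + (\<Sum>i<q. of_nat (c (Suc p) (Suc i)) * t (p + q - i))"
      unfolding c_rec c_0 by (simp only: of_nat_add distrib_right sum.distrib add.assoc)
    also have "\<dots> = (\<Sum>i\<le>q. of_nat (c (Suc p) i) * t (Suc p + q - i))"
      by (subst sum.atMost_shift) simp
    finally show "Poly_Mapping.lookup (x (n - 1) \<odot> (y p \<odot> y q) - galg_scale (of_nat (2 * p)) (y p \<odot> y q)) w =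
        Poly_Mapping.lookup (\<Sum>i\<le>q. galg_scale (of_nat (c (Suc p) i)) (y (Suc p + q - i))) w"
      by (simp add: lookup_sum t_def)
  qed
  finally show ?case by (simp add: c_def)
qed

text \<open>With p = n - j and q = n - k, the substitution is l = n - (p + q - i), that is, i = n +
  l - j - k. Where this truncates, k - l > n - j and a binomial vanishes; on the other side the
  terms with i > p or p + q - i > n vanish.\<close>

lemma x_mult:
  assumes j: "1 \<le> j" "j \<le> n" and k: "1 \<le> k" "k \<le> n"
  shows "x j \<odot> x k = (\<Sum>l=0..min j k.
    galg_scale (of_nat (((n - j) choose (k - l)) * ((n - k) choose (j - l)) *
      fact (n + l - j - k) * 2 ^ (n + l - j - k))) (x l))"
proof -
  define p q where "p = n - j" and "q = n - k"
  have jk: "j = n - p" "k = n - q" "p < n" "q < n" using j k by (auto simp: p_def q_def)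
  define g where
    "g = (\<lambda>i. galg_scale (of_nat ((p choose i) * (q choose i) * fact i * 2 ^ i)) (y (p + q - i)))"
  define h where
    "h = (\<lambda>l. galg_scale (of_nat (((n - j) choose (k - l)) * ((n - k) choose (j - l)) *
      fact (n + l - j - k) * 2 ^ (n + l - j - k))) (x l))"
  have "x j \<odot> x k = (\<Sum>i\<le>q. g i)" using jk y_mult[of p q] by (simp add: y_def[of p] y_def[of q] g_def)
  also have "\<dots> = (\<Sum>i | i \<le> q \<and> i \<le> p \<and> p + q \<le> n + i. g i)"
  proof (rule sum.mono_neutral_right)
    show "\<forall>i\<in>{..q} - {i. i \<le> q \<and> i \<le> p \<and> p + q \<le> n + i}. g i = 0"
    proof
      fix i assume "i \<in> {..q} - {i. i \<le> q \<and> i \<le> p \<and> p + q \<le> n + i}"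
      then have "p < i \<or> \<not> p + q - i \<le> n" by auto
      then show "g i = 0" by (auto simp: g_def y_def binomial_eq_0)
    qed
  qed auto
  also have "\<dots> = (\<Sum>l | l \<le> j \<and> l \<le> k \<and> j + k \<le> n + l. h l)"
  proof (rule sum.reindex_bij_witness[where i = "\<lambda>l. n + l - j - k" and j = "\<lambda>i. n + i - p - q"])
    fix i assume "i \<in> {i. i \<le> q \<and> i \<le> p \<and> p + q \<le> n + i}"
    then have i: "i \<le> q" "i \<le> p" "p + q \<le> n + i" by auto
    show "n + (n + i - p - q) - j - k = i" using i jk by simp
    show "n + i - p - q \<in> {l. l \<le> j \<and> l \<le> k \<and> j + k \<le> n + l}" using i jk by auto
    have "k - (n + i - p - q) = p - i" "j - (n + i - p - q) = q - i"
      "n - (p + q - i) = n + i - p - q" "p + q - i \<le> n"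
      using i jk by auto
    moreover have "p choose (p - i) = p choose i" "q choose (q - i) = q choose i"
      using i by (simp_all flip: binomial_symmetric)
    moreover have "n + (n + i - p - q) - j - k = i" using i jk by simp
    ultimately show "h (n + i - p - q) = g i"
      unfolding g_def h_def p_def[symmetric] q_def[symmetric] by (simp add: y_def)
  next
    fix l assume "l \<in> {l. l \<le> j \<and> l \<le> k \<and> j + k \<le> n + l}"
    then have l: "l \<le> j" "l \<le> k" "j + k \<le> n + l" by auto
    show "n + (n + l - j - k) - p - q = l" using l j k by (simp add: p_def q_def)
    show "n + l - j - k \<in> {i. i \<le> q \<and> i \<le> p \<and> p + q \<le> n + i}"
      using l j k by (auto simp: p_def q_def)
  qed
  also have "\<dots> = (\<Sum>l=0..min j k. h l)"
  proof (rule sum.mono_neutral_left)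
    show "\<forall>l\<in>{0..min j k} - {l. l \<le> j \<and> l \<le> k \<and> j + k \<le> n + l}. h l = 0"
    proof
      fix l assume "l \<in> {0..min j k} - {l. l \<le> j \<and> l \<le> k \<and> j + k \<le> n + l}"
      then have "n - j < k - l" using j(2) by (auto simp: atLeastAtMost_iff)
      then show "h l = 0" by (simp add: h_def binomial_eq_0)
    qed
  qed (auto simp: atLeastAtMost_iff)
  finally show ?thesis by (simp only: h_def)
qed

text \<open>Only l = 0 and l = 1 occur. Since x_0 = 2 x_1, both coefficients share the factor (n -
  j)! 2^(n - j), and Pascal's rule adds the binomials to n choose j.\<close>

lemma x_mult_x_1:
  assumes j: "1 \<le> j" "j \<le> n"
  shows "x j \<odot> x 1 = galg_scale (fact n / fact j * 2 ^ (n - j)) (x 1)"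
proof -
  have coeff: "(of_nat ((n - j) * ((n - 1) choose j) * fact (n - j - 1) * 2 ^ (n - j - 1)) * 2 +
      of_nat (((n - 1) choose (j - 1)) * fact (n - j) * 2 ^ (n - j)) :: rat) =
      of_nat ((n choose j) * fact (n - j) * 2 ^ (n - j))"
  proof (cases "j = n")
    case True
    then show ?thesis using j by simp
  next
    case False
    obtain d where d: "n - j = Suc d" using False j by (cases "n - j") auto
    obtain m i where mi: "n = Suc m" "j = Suc i" using j by (cases n; cases j) auto
    have "(n choose j) = ((n - 1) choose (j - 1)) + ((n - 1) choose j)" by (simp add: mi)
    then show ?thesis unfolding d by (simp add: algebra_simps)
  qed
  have quot: "of_nat ((n choose j) * fact (n - j) * 2 ^ (n - j)) = (fact n / fact j * 2 ^ (n - j) :: rat)"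
    by (simp add: binomial_fact[OF j(2)])
  have "min j 1 = 1" using j by simp
  then have "x j \<odot> x 1 =
      galg_scale (of_nat ((n - j) * ((n - 1) choose j) * fact (n - j - 1) * 2 ^ (n - j - 1))) (x 0) +
      galg_scale (of_nat (((n - 1) choose (j - 1)) * fact (n - j) * 2 ^ (n - j))) (x 1)"
    using x_mult[OF j, of 1] n3 by (simp add: One_nat_def)
  also have "\<dots> = galg_scale (of_nat ((n - j) * ((n - 1) choose j) * fact (n - j - 1) * 2 ^ (n - j - 1)) * 2 +
      of_nat (((n - 1) choose (j - 1)) * fact (n - j) * 2 ^ (n - j))) (x 1)"
    by (simp only: x_0 galg_scale_scale galg_scale_add_left)
  finally show ?thesis unfolding coeff quot .
qed

end

theorem corollary3p12:
  fixes W :: "('a, 'b) monoid_scheme" and n :: nat and s :: "nat \<Rightarrow> 'a"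
  assumes "n \<ge> 3"
    and "coxeter_system_D W n s"
  shows "(\<forall>j\<in>{1..n}. \<forall>k\<in>{1..n}.
            galg_mult W (x_D W n s j) (x_D W n s k) =
              (\<Sum>l=0..min j k.
                 galg_scale
                   (of_nat (((n - j) choose (k - l)) * ((n - k) choose (j - l)) *
                      fact (n + l - j - k) * 2 ^ (n + l - j - k)))
                   (x_D W n s l))) \<and>
         (\<forall>j\<in>{1..n}.
            galg_mult W (x_D W n s j) (x_D W n s 1) =
              galg_scale (fact n / fact j * 2 ^ (n - j)) (x_D W n s 1))"
proof -
  interpret coxeter_D W n s
    by standard (fact assms)+
  show ?thesis
    by (intro conjI ballI) (rule x_mult x_mult_x_1; simp add: atLeastAtMost_iff)+
qed

end
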